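(* Let $\mathcal{X}\subset\mathbb{R}^n$ be closed, let $f,R:\mathbb{R}^n\to\mathbb{R}$ be locally Lipschitz continuous, $h:=f+R$, let $D_f,D_R:\mathbb{R}^n\rightrightarrows\mathbb{R}^n$ be set-valued mappings, $\phi:\mathbb{R}^n\to\mathbb{R}$ a function, $\{\eta_k\}$ a positive sequence, $\{\delta_k\},\{\nu_k\}$ nonnegative sequences. Let $\{x_k\}\subset\mathcal{X}$ be generated by the stochastic Bregman proximal subgradient method (SBPG): for each $k\ge0$, $x_{k+1}\in\mathcal{X}$ is an approximate minimizer over $\mathcal{X}$ of $x\mapsto\langle g_k,x-x_k\rangle+\frac1{\eta_k}\mathcal{D}_\phi(x,x_k)+R(x)$ in the sense that $$\langle g_k,x_{k+1}-x_k\rangle+\frac1{\eta_k}\mathcal{D}_\phi(x_{k+1},x_k)+R(x_{k+1})\le R(x_k)$$ and $$\mathrm{dist}\left(0,\;g_k+\frac1{\eta_k}(\nabla\phi(x_{k+1})-\nabla\phi(x_k))+D_R(x_{k+1})+N^L_{\mathcal{X}}(x_{k+1})\right)\le\nu_k,$$ where $g_k=d_{f,k}+\xi_k$, $d_{f,k}\in D_f^{\delta_k}(x_k)$ and $\xi_k$ is stochastic noise. Equivalently, $\nabla\phi(x_{k+1})=\nabla\phi(x_k)-\eta_k(d_{f,k}+d_{R,k}+d_{\mathcal{X},k}+d_{e,k}+\xi_k)$ with $d_{R,k}\in D_R(x_{k+1})$, $d_{\mathcal{X},k}\in N^L_{\mathcal{X}}(x_{k+1})$, $\|d_{e,k}\|\le\nu_k$.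 Suppose that: (1) $\phi$ is a supercoercive Legendre kernel function over $\mathbb{R}^n$, $\phi$ is locally strongly convex, $\nabla\phi$ is locally Lipschitz continuous, and for any absolutely continuous mapping $z(\cdot)\in\mathcal{C}(\mathbb{R}_+,\mathbb{R}^n)$, $\nabla^2\phi(z(s))$ is positive definite for almost all $s\ge0$; (2) $\{x_k\}$, $\{\nabla\phi(x_k)\}$, $\{d_{f,k}\}$ and $\{d_{R,k}\}$ are uniformly bounded almost surely; (3) $\{\xi_k\}$ is a uniformly bounded martingale difference noise ($\mathbb{E}[\xi_{k+1}|\mathcal{F}_k]=0$ almost surely and $\sup_{k\ge0}\|\xi_k\|<\infty$), $\sum_{k=0}^\infty\eta_k=\infty$ and $\eta_k=o(1/\log k)$; (4) $\lim_{k\to\infty}\delta_k=0$ and $\lim_{k\to\infty}\nu_k=0$; (5) for any $\eta>0$, $\eta R+\phi$ is supercoercive; (6) $h$ is bounded below, $D_f$ and $D_R$ are convex-valued conservative fields for $f$ and $R$ respectively, and $\mathcal{X}$ admits a chain rule; (7) the critical value set $\{h(x):0\in D_f(x)+D_R(x)+N_{\mathcal{X}}(x)\}$ has empty interior in $\mathbb{R}$. Then, almost surely, any cluster point $x^*$ of $\{x_k\}$ is an $\mathcal{H}$-stationary point, where $\mathcal{H}:=D_f+D_R+N_{\mathcal{X}}$ (i.e. $0\in D_f(x^* )+D_R(x^* )+N_{\mathcal{X}}(x^* )$), and the function values $\{f(x_k)+R(x_k)\}$ converge.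
   Context: $(\Omega,\mathcal{F},\mathbb{P})$ is a probability space and $\mathcal{F}_k=\sigma(\xi_0,\ldots,\xi_k)$. $\mathcal{D}_\phi(x,y)=\phi(x)-\phi(y)-\langle\nabla\phi(y),x-y\rangle$. A Legendre kernel function over $\mathbb{R}^n$ is a strictly convex $\phi\in\mathcal{C}^1(\mathbb{R}^n)$ such that $\|\nabla\phi(u_k)\|\to\infty$ whenever $\|u_k\|\to\infty$. A function $g$ is supercoercive if $\lim_{\|u\|\to\infty}g(u)/\|u\|=\infty$. For a set-valued mapping $S$ and $\delta\ge0$, $S^\delta(x)=\bigcup_{\|y-x\|\le\delta}(S(y)+\delta\mathbb{B}^n)$, $\mathbb{B}^n$ the unit ball. A conservative field for a locally Lipschitz $f$ is a nonempty-closed-valued, closed-graph mapping $D_f:\mathbb{R}^n\rightrightarrows\mathbb{R}^n$ such that for every absolutely continuous $\gamma:[0,1]\to\mathbb{R}^n$, $\frac{d}{dt}(f\circ\gamma)(t)=\langle v,\dot\gamma(t)\rangle$ for all $v\in D_f(\gamma(t))$ and almost all $t$. For $\bar x\in\mathcal{X}$: the regular normal cone is $\hat N_{\mathcal{X}}(\bar x)=\{v:\langle v,x-\bar x\rangle\le o(\|x-\bar x\|)\text{ for }x\in\mathcal{X}\}$; the limiting normal cone $N^L_{\mathcal{X}}(\bar x)$ is the set of limits $v=\lim v_k$ with $v_k\in\hat N_{\mathcal{X}}(x_k)$, $x_k\in\mathcal{X}$, $x_k\to\bar x$; the normal cone is $N_{\mathcal{X}}(\bar x)=\mathrm{cl\,conv}(N^L_{\mathcal{X}}(\bar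 x))$. $\mathcal{X}$ admits a chain rule if for any absolutely continuous $\gamma:[0,1]\to\mathcal{X}$, $\langle v,\dot\gamma(t)\rangle=0$ for all $v\in N_{\mathcal{X}}(\gamma(t))$ and almost all $t\in[0,1]$. Sums of sets are Minkowski sums; $\mathrm{dist}(w,A)=\inf_{u\in A}\|w-u\|$. Normal cones are taken to be empty at points outside $\mathcal{X}$. *)

theory Defs
  imports "HOL-Probability.Probability" "HOL-Library.Landau_Symbols"
begin

text \<open>Sums of sets written \<open>A + B\<close> are the Minkowski sums of \<open>HOL-Library.Set_Algebras\<close>.\<close>

section \<open>Smooth and nonsmooth analysis\<close>

definition gradient :: "('a::real_inner \<Rightarrow> real) \<Rightarrow> 'a \<Rightarrow> 'a" where
  "gradient f x = (THE g. GDERIV f x :> g)"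

definition locally_lipschitz :: "('a::metric_space \<Rightarrow> 'b::metric_space) \<Rightarrow> bool" where
  "locally_lipschitz f \<longleftrightarrow> (\<forall>x. \<exists>r>0. \<exists>L. L-lipschitz_on (ball x r) f)"

definition strictly_convex :: "('a::real_vector \<Rightarrow> real) \<Rightarrow> bool" where
  "strictly_convex f \<longleftrightarrow>
    (\<forall>x y t. x \<noteq> y \<and> 0 < t \<and> t < 1 \<longrightarrow>
      f ((1 - t) *\<^sub>R x + t *\<^sub>R y) < (1 - t) * f x + t * f y)"

definition locally_strongly_convex :: "('a::real_inner \<Rightarrow> real) \<Rightarrow> bool" where
  "locally_strongly_convex f \<longleftrightarrow>
    (\<forall>x. \<exists>r>0. \<exists>\<mu>>0. convex_on (ball x r) (\<lambda>y. f y - \<mu> / 2 * (norm y)\<^sup>2))"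

definition supercoercive :: "('a::real_normed_vector \<Rightarrow> real) \<Rightarrow> bool" where
  "supercoercive g \<longleftrightarrow> filterlim (\<lambda>u. g u / norm u) at_top at_infinity"

definition legendre_kernel :: "('a::real_inner \<Rightarrow> real) \<Rightarrow> bool" where
  "legendre_kernel \<phi> \<longleftrightarrow>
    strictly_convex \<phi> \<and>
    (\<forall>x. \<phi> differentiable (at x)) \<and> continuous_on UNIV (gradient \<phi>) \<and>
    (\<forall>u :: nat \<Rightarrow> 'a. filterlim (\<lambda>k. norm (u k)) at_top sequentially \<longrightarrow>
      filterlim (\<lambda>k. norm (gradient \<phi> (u k))) at_top sequentially)"

definition bregman :: "('a::real_inner \<Rightarrow> real) \<Rightarrow> 'a \<Rightarrow> 'a \<Rightarrow> real" where
  "bregman \<phi> x y = \<phi> x - \<phi> y - gradient \<phi> y \<bullet> (x - y)"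

text \<open>The Hessian at \<open>x\<close> is the Frechet derivative \<open>H\<close> of the gradient; it is required to exist.
  Its symmetry is automatic for the derivative of a gradient.\<close>

definition hessian_pos_def_at :: "('a::real_inner \<Rightarrow> real) \<Rightarrow> 'a \<Rightarrow> bool" where
  "hessian_pos_def_at \<phi> x \<longleftrightarrow>
    (\<exists>H. (gradient \<phi> has_derivative H) (at x) \<and> (\<forall>v. v \<noteq> 0 \<longrightarrow> 0 < v \<bullet> H v))"

section \<open>Absolutely continuous curves\<close>

definition abs_continuous_on :: "real set \<Rightarrow> (real \<Rightarrow> 'a::metric_space) \<Rightarrow> bool" where
  "abs_continuous_on S \<gamma> \<longleftrightarrow>
    (\<forall>\<epsilon>>0. \<exists>\<delta>>0. \<forall>(n::nat) a b.
      (\<forall>i<n. a i \<le> b i \<and> {a i..b i} \<subseteq> S) \<and>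
      disjoint_family_on (\<lambda>i. {a i<..<b i}) {..<n} \<and>
      (\<Sum>i<n. b i - a i) < \<delta> \<longrightarrow>
      (\<Sum>i<n. dist (\<gamma> (a i)) (\<gamma> (b i))) < \<epsilon>)"

text \<open>On the half-line, absolute continuity is understood on every compact interval.\<close>

definition abs_continuous_halfline :: "(real \<Rightarrow> 'a::metric_space) \<Rightarrow> bool" where
  "abs_continuous_halfline z \<longleftrightarrow> (\<forall>T>0. abs_continuous_on {0..T} z)"

section \<open>Set-valued mappings\<close>

definition enlargement :: "real \<Rightarrow> ('a::real_normed_vector \<Rightarrow> 'a set) \<Rightarrow> 'a \<Rightarrow> 'a set" where
  "enlargement \<delta> S x = (\<Union>y\<in>cball x \<delta>. S y + cball 0 \<delta>)"

text \<open>In the next definition and in \<open>admits_chain_rule\<close>, the statement at \<open>t\<close> includes that \<open>\<gamma>\<close> is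
  differentiable at \<open>t\<close>, which holds for almost every \<open>t\<close> as \<open>\<gamma>\<close> is absolutely continuous. The values
  of \<open>\<gamma>\<close> outside \<open>{0..1}\<close> only affect the derivatives at the two end points.\<close>

definition conservative_field ::
    "('a::euclidean_space \<Rightarrow> 'a set) \<Rightarrow> ('a \<Rightarrow> real) \<Rightarrow> bool" where
  "conservative_field D f \<longleftrightarrow>
    locally_lipschitz f \<and>
    (\<forall>x. D x \<noteq> {} \<and> closed (D x)) \<and>
    closed {(x, v). v \<in> D x} \<and>
    (\<forall>\<gamma>. abs_continuous_on {0..1} \<gamma> \<longrightarrow>
      (AE t in lborel. t \<in> {0..1} \<longrightarrow>
        (\<exists>\<gamma>'. (\<gamma> has_vector_derivative \<gamma>') (at t) \<and>
          (\<forall>v\<in>D (\<gamma> t). ((\<lambda>s. f (\<gamma> s)) has_real_derivative (v \<bullet> \<gamma>')) (at t)))))"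

section \<open>Normal cones\<close>

definition regular_normal_cone :: "'a::real_inner set \<Rightarrow> 'a \<Rightarrow> 'a set" where
  "regular_normal_cone X x =
    {v. x \<in> X \<and> (\<forall>\<epsilon>>0. \<forall>\<^sub>F y in at x within X. v \<bullet> (y - x) \<le> \<epsilon> * norm (y - x))}"

definition limiting_normal_cone :: "'a::real_inner set \<Rightarrow> 'a \<Rightarrow> 'a set" where
  "limiting_normal_cone X x =
    {v. x \<in> X \<and> (\<exists>xs vs. (\<forall>k::nat. xs k \<in> X \<and> vs k \<in> regular_normal_cone X (xs k)) \<and>
          xs \<longlonglongrightarrow> x \<and> vs \<longlonglongrightarrow> v)}"

definition normal_cone :: "'a::real_inner set \<Rightarrow> 'a \<Rightarrow> 'a set" where
  "normal_cone X x = closure (convex hull (limiting_normal_cone X x))"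

definition admits_chain_rule :: "'a::euclidean_space set \<Rightarrow> bool" where
  "admits_chain_rule X \<longleftrightarrow>
    (\<forall>\<gamma>. abs_continuous_on {0..1} \<gamma> \<and> \<gamma> ` {0..1} \<subseteq> X \<longrightarrow>
      (AE t in lborel. t \<in> {0..1} \<longrightarrow>
        (\<exists>\<gamma>'. (\<gamma> has_vector_derivative \<gamma>') (at t) \<and>
          (\<forall>v\<in>normal_cone X (\<gamma> t). v \<bullet> \<gamma>' = 0))))"

section \<open>Noise\<close>

text \<open>\<open>natural_filtration M \<xi> k\<close> is generated by \<open>\<xi> 0, \<dots>, \<xi> k\<close>; only its space and its measurable
  sets matter.\<close>

definition natural_filtration ::
    "'w measure \<Rightarrow> (nat \<Rightarrow> 'w \<Rightarrow> 'a::topological_space) \<Rightarrow> nat \<Rightarrow> 'w measure" where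
  "natural_filtration M \<xi> k =
    sigma (space M) (\<Union>i\<le>k. {\<xi> i -` A \<inter> space M | A. A \<in> sets borel})"

text \<open>The library's conditional expectation is real-valued, so that of a random vector is taken
  coordinatewise. Uniform boundedness is by a single deterministic constant.\<close>

definition bounded_martingale_difference ::
    "'w measure \<Rightarrow> (nat \<Rightarrow> 'w \<Rightarrow> 'a::euclidean_space) \<Rightarrow> bool" where
  "bounded_martingale_difference M \<xi> \<longleftrightarrow>
    (\<forall>k. \<xi> k \<in> borel_measurable M) \<and>
    (\<forall>k. \<forall>b\<in>Basis. AE \<omega> in M.
      real_cond_exp M (natural_filtration M \<xi> k) (\<lambda>w. \<xi> (Suc k) w \<bullet> b) \<omega> = 0) \<and>
    (\<exists>C. \<forall>k. AE \<omega> in M. norm (\<xi> k \<omega>) \<le> C)"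

section \<open>The stochastic Bregman proximal subgradient method\<close>

text \<open>One trajectory of the method. The \<open>infdist\<close> condition is the approximate optimality
  condition (the set involved is nonempty, so the convention \<open>infdist 0 {} = 0\<close> plays no role);
  the remaining conjuncts are its decomposed form, which names the elements
  \<open>dR k\<close>, \<open>dX k\<close>, \<open>de k\<close>.\<close>

definition sbpg_trajectory ::
    "'a::euclidean_space set \<Rightarrow> ('a \<Rightarrow> real) \<Rightarrow> ('a \<Rightarrow> real) \<Rightarrow> ('a \<Rightarrow> 'a set) \<Rightarrow> ('a \<Rightarrow> 'a set) \<Rightarrow>
     (nat \<Rightarrow> real) \<Rightarrow> (nat \<Rightarrow> real) \<Rightarrow> (nat \<Rightarrow> real) \<Rightarrow>
     (nat \<Rightarrow> 'a) \<Rightarrow> (nat \<Rightarrow> 'a) \<Rightarrow> (nat \<Rightarrow> 'a) \<Rightarrow> (nat \<Rightarrow> 'a) \<Rightarrow> (nat \<Rightarrow> 'a) \<Rightarrow> (nat \<Rightarrow> 'a) \<Rightarrow> bool" where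
  "sbpg_trajectory X \<phi> R Df DR \<eta> \<delta> \<nu> x df dR dX de \<xi> \<longleftrightarrow>
    (\<forall>k. x k \<in> X) \<and>
    (\<forall>k. df k \<in> enlargement (\<delta> k) Df (x k)) \<and>
    (\<forall>k. (df k + \<xi> k) \<bullet> (x (Suc k) - x k) + 1 / \<eta> k * bregman \<phi> (x (Suc k)) (x k) + R (x (Suc k))
          \<le> R (x k)) \<and>
    (\<forall>k. infdist 0
          ({df k + \<xi> k + (1 / \<eta> k) *\<^sub>R (gradient \<phi> (x (Suc k)) - gradient \<phi> (x k))}
            + DR (x (Suc k)) + limiting_normal_cone X (x (Suc k))) \<le> \<nu> k) \<and>
    (\<forall>k. dR k \<in> DR (x (Suc k))) \<and>
    (\<forall>k. dX k \<in> limiting_normal_cone X (x (Suc k))) \<and>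
    (\<forall>k. norm (de k) \<le> \<nu> k) \<and>
    (\<forall>k. gradient \<phi> (x (Suc k)) =
          gradient \<phi> (x k) - \<eta> k *\<^sub>R (df k + dR k + dX k + de k + \<xi> k))"

end

theory Submission
  imports Defs
begin

text \<open>
  In the variable \<open>y = gradient \<phi> (x)\<close> the method is a noisy discretisation of the differential
  inclusion \<open>y' \<in> - (Df z + DR z + N z)\<close>, where \<open>y = gradient \<phi> (z)\<close> and \<open>N\<close> is the normal cone of \<open>X\<close>.
  Along a solution the chain rules give \<open>(h \<circ> z)' = - y' \<bullet> z'\<close> for \<open>h = f + R\<close>, and local strong convexity
  of \<open>\<phi>\<close> makes this at most \<open>- \<mu> (norm z')\<^sup>2\<close>. So \<open>h\<close> decreases strictly unless the solution rests at a
  point where the field contains \<open>0\<close>. The proof transfers this to the iterates.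

  \<^item> The iterates move with bounded speed. The descent condition and local strong convexity
    give \<open>norm (x (k + 1) - x k) = O(\<eta> k)\<close> (\<open>step_size_bound\<close>). Then the increments of \<open>gradient \<phi> \<circ> x\<close> are
    \<open>O(\<eta> k)\<close> too, and the update shows that the normal vectors are bounded. The field can
    therefore be truncated to one with compact convex values and closed graph (\<open>truncated_field\<close>).
  \<^item> The noise averages out. For a fixed time length, the sum of \<open>\<eta> i *\<^sub>R \<xi> i\<close> over the window starting at
    \<open>n\<close> tends to \<open>0\<close> almost surely, by an exponential tail bound and the Borel--Cantelli lemma; this uses
    \<open>\<eta> k = o(1 / ln k)\<close> (\<open>window_noise_tendsto_0\<close>).
  \<^item> Limits of pieces of the trajectory solve the inclusion. A pointwise limit of pieces of the trajectory
    restarted at later and later times is Lipschitz, and wherever its image under \<open>gradient \<phi>\<close> is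
    differentiable the inclusion follows
    by averaging the drifts over short windows (\<open>limit_curve\<close>).
  \<^item> If \<open>h\<close> does not fall below \<open>h xs\<close> for some fixed time after the iterates visit \<open>xs\<close>, then the limit
    curve from \<open>xs\<close> is at rest and \<open>xs\<close> is stationary (\<open>stationary_if_no_descent\<close>).

  The last principle is used twice. If the values \<open>h (x k)\<close> oscillated, they would cross some noncritical level
  upwards infinitely often and stay above it for a fixed time, making the level critical
  (\<open>values_convergent\<close>). And once the values converge, their limit is \<open>h xs\<close> for every cluster point \<open>xs\<close>,
  so every cluster point is stationary (\<open>cluster_point_stationary\<close>).
\<close>

section \<open>Lipschitz functions with nonpositive derivative almost everywhere\<close>

text \<open>The largest point of \<open>[a, b]\<close> where \<open>G \<ge> G a\<close> exists by continuity, and it can only be \<open>b\<close>: from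
  any earlier point, \<open>G\<close> does not drop when moving a little to the right.\<close>

lemma le_if_locally_right_increasing:
  fixes G :: "real \<Rightarrow> real"
  assumes "a \<le> b" and cont: "continuous_on {a..b} G"
    and right: "\<And>t. a \<le> t \<Longrightarrow> t < b \<Longrightarrow> \<forall>\<^sub>F s in at_right t. G t \<le> G s"
  shows "G a \<le> G b"
proof -
  define A where "A = {t \<in> {a..b}. G a \<le> G t}"
  have "closed A"
    unfolding A_def by (intro continuous_on_closed_Collect_le continuous_intros cont)
  moreover have "bounded A"
    by (rule bounded_subset[of "{a..b}"]) (auto simp: A_def)
  moreover have "a \<in> A" using \<open>a \<le> b\<close> by (auto simp: A_def)
  ultimately obtain c where c: "c \<in> A" "\<And>t. t \<in> A \<Longrightarrow> t \<le> c"
    by (metis compact_attains_sup compact_eq_bounded_closed empty_iff)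
  show ?thesis
  proof (cases "c = b")
    case False
    hence "a \<le> c" "c < b" using c by (auto simp: A_def)
    hence "\<forall>\<^sub>F s in at_right c. G c \<le> G s \<and> s < b \<and> c < s"
      using right[of c] eventually_at_rightI[of c b "\<lambda>s. s < b \<and> c < s"]
      by (auto simp: eventually_conj_iff)
    then obtain s where "G c \<le> G s" "s < b" "c < s"
      by (metis (no_types, lifting) eventually_happens trivial_limit_at_right_real)
    hence "s \<in> A" using c \<open>a \<le> c\<close> by (auto simp: A_def)
    thus ?thesis using c \<open>c < s\<close> by fastforce
  qed (use c in \<open>auto simp: A_def\<close>)
qed

text \<open>This is the half of the fundamental theorem of calculus for Lipschitz functions on which every
  Lyapunov argument below rests. The exceptional null set lies in an open set \<open>U\<close> of measure below
  \<open>e\<close>. In \<open>G t = K m(U \<inter> [a, t]) + e t - g t\<close> the first term grows at rate \<open>K\<close> on \<open>U\<close>, which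
  beats the largest possible increase of \<open>g\<close> there; off \<open>U\<close> the derivative of \<open>g\<close> is nonpositive
  and the term \<open>e t\<close> decides. So \<open>G\<close> increases, and \<open>e \<rightarrow> 0\<close> gives the claim.\<close>

lemma nonincreasing_if_AE_deriv_nonpos:
  fixes g :: "real \<Rightarrow> real"
  assumes "a \<le> b" and "r > 0"
    and lip: "\<And>s t. s \<in> {a..b} \<Longrightarrow> t \<in> {a..b} \<Longrightarrow> \<bar>s - t\<bar> < r \<Longrightarrow> \<bar>g s - g t\<bar> \<le> L * \<bar>s - t\<bar>"
    and deriv: "AE t in lborel. t \<in> {a<..<b} \<longrightarrow> (\<exists>D\<le>0. (g has_real_derivative D) (at t))"
  shows "g b \<le> g a"
proof -
  define K where "K = \<bar>L\<bar>"
  have "K \<ge> 0" by (simp add: K_def)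
  have lip: "\<bar>g s - g t\<bar> \<le> K * \<bar>s - t\<bar>" if "s \<in> {a..b}" "t \<in> {a..b}" "\<bar>s - t\<bar> < r" for s t
    using lip[OF that] mult_right_mono[of L K "\<bar>s - t\<bar>"] unfolding K_def by linarith
  obtain N where N: "N \<in> null_sets lborel"
      "{t. \<not> (t \<in> {a<..<b} \<longrightarrow> (\<exists>D\<le>0. (g has_real_derivative D) (at t)))} \<subseteq> N"
    using deriv unfolding eventually_ae_filter by auto
  have bound: "g b - g a \<le> e * (K + (b - a))" if "e > 0" for e
  proof -
    \<comment> \<open>The left end point has no derivative hypothesis, so it is added to the exceptional set.\<close>
    have "{a} \<in> null_sets lborel" by (auto simp: null_sets_def)
    hence N': "insert a N \<in> null_sets lborel"
      using N(1) null_sets.Un[of "{a}" lborel N] by simp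
    obtain U where U: "open U" "insert a N \<subseteq> U" "emeasure lborel (U - insert a N) < e"
      using outer_regular_lborel[of "insert a N" e] N' \<open>e > 0\<close> by (auto simp: null_sets_def)
    have Ub [measurable]: "U \<in> sets lborel" using U(1) by simp
    have "emeasure lborel U = emeasure lborel (U - insert a N)"
      by (rule emeasure_Diff_null_set[OF N' Ub, symmetric])
    hence mU: "emeasure lborel U < e" using U(3) by simp
    define m where "m t = measure lborel (U \<inter> {a..t})" for t
    have fin: "emeasure lborel (U \<inter> A) < \<infinity>" if "A \<in> sets lborel" for A
    proof -
      have "emeasure lborel (U \<inter> A) \<le> emeasure lborel U"
        using Ub by (intro emeasure_mono) auto
      also note mU
      also have "ennreal e < \<infinity>" by simp
      finally show ?thesis .
    qed
    have split: "m t = m s + measure lborel (U \<inter> {s<..t})" if "a \<le> s" "s \<le> t" for s t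
    proof -
      have "U \<inter> {a..t} = (U \<inter> {a..s}) \<union> (U \<inter> {s<..t})" using that by auto
      thus ?thesis unfolding m_def
        by (subst measure_Un_AE[symmetric])
           (use fin in \<open>auto simp: fmeasurable_def\<close>)
    qed
    have step: "0 \<le> measure lborel (U \<inter> {s<..t})" "measure lborel (U \<inter> {s<..t}) \<le> t - s" if "s \<le> t" for s t
    proof -
      have "measure lborel (U \<inter> {s<..t}) \<le> measure lborel {s<..t}"
        by (rule measure_mono_fmeasurable) (use that in \<open>auto simp: fmeasurable_def\<close>)
      thus "measure lborel (U \<inter> {s<..t}) \<le> t - s" using that by simp
    qed simp
    have m_diff: "\<bar>m t - m s\<bar> \<le> \<bar>t - s\<bar>" if "a \<le> s" "a \<le> t" for s t
      using split[of s t] split[of t s] step[of s t] step[of t s] that by (cases "s \<le> t") auto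
    define G where "G t = K * m t + e * t - g t" for t
    have "G a \<le> G b"
    proof (rule le_if_locally_right_increasing[OF \<open>a \<le> b\<close>])
      have "continuous_on {a..b} m"
        unfolding continuous_on_iff dist_real_def
        by (metis atLeastAtMost_iff m_diff order_le_less_trans)
      moreover have "continuous_on {a..b} g"
        unfolding continuous_on_iff dist_real_def
      proof (intro ballI allI impI)
        fix x \<epsilon> :: real assume x: "x \<in> {a..b}" "\<epsilon> > 0"
        have "\<bar>g x' - g x\<bar> < \<epsilon>" if "x' \<in> {a..b}" "\<bar>x' - x\<bar> < min r (\<epsilon> / (K + 1))" for x'
        proof -
          have "\<bar>g x' - g x\<bar> \<le> K * \<bar>x' - x\<bar>" using lip that x by auto
          also have "\<dots> \<le> (K + 1) * \<bar>x' - x\<bar>" by (intro mult_right_mono) auto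
          also have "\<dots> < \<epsilon>" using that \<open>K \<ge> 0\<close> by (simp add: field_simps)
          finally show ?thesis .
        qed
        thus "\<exists>d>0. \<forall>x'\<in>{a..b}. \<bar>x' - x\<bar> < d \<longrightarrow> \<bar>g x' - g x\<bar> < \<epsilon>"
          using \<open>r > 0\<close> \<open>K \<ge> 0\<close> x by (intro exI[of _ "min r (\<epsilon> / (K + 1))"]) auto
      qed
      ultimately show "continuous_on {a..b} G"
        unfolding G_def by (intro continuous_intros)
    next
      fix t assume t: "a \<le> t" "t < b"
      show "\<forall>\<^sub>F s in at_right t. G t \<le> G s"
      proof (cases "t \<in> U")
        case True
        then obtain d where d: "d > 0" "\<And>s. \<bar>s - t\<bar> < d \<Longrightarrow> s \<in> U"
          using U(1) unfolding open_dist dist_real_def by metis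
        have "G t \<le> G s" if s: "t < s" "s < t + min (b - t) (min r d)" for s
        proof -
          have "U \<inter> {t<..s} = {t<..s}" using d(2) s by force
          hence ms: "m s = m t + (s - t)" using split[of t s] t s by auto
          have "g s - g t \<le> K * (s - t)" using lip[of s t] s t by (auto simp: min_def split: if_splits)
          moreover have "K * m s = K * m t + K * (s - t)" unfolding ms by (simp add: algebra_simps)
          moreover have "e * t \<le> e * s" using s \<open>e > 0\<close> by simp
          ultimately show ?thesis unfolding G_def by linarith
        qed
        thus ?thesis using t d \<open>r > 0\<close>
          unfolding eventually_at_right_field by (intro exI[of _ "t + min (b - t) (min r d)"]) auto
      next
        case False
        hence "t \<noteq> a" "t \<notin> N" using U(2) by auto
        then obtain D where D: "D \<le> 0" "(g has_real_derivative D) (at t)"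
          using N(2) t by force
        have "((\<lambda>s. e * s - g s) has_real_derivative e - D) (at t)"
          by (auto intro!: derivative_eq_intros D(2))
        moreover have "e - D > 0" using D \<open>e > 0\<close> by simp
        ultimately obtain d where d: "d > 0" "\<And>h. h > 0 \<Longrightarrow> h < d \<Longrightarrow> e * t - g t < e * (t + h) - g (t + h)"
          using DERIV_pos_inc_right by blast
        have "G t \<le> G s" if s: "t < s" "s < t + d" for s
        proof -
          have "m t \<le> m s" using split[of t s] step[of t s] s t by auto
          hence "K * m t \<le> K * m s" using \<open>K \<ge> 0\<close> by (rule mult_left_mono)
          thus ?thesis using d(2)[of "s - t"] s by (auto simp: G_def)
        qed
        thus ?thesis using d
          unfolding eventually_at_right_field by (intro exI[of _ "t + d"]) auto
      qed
    qed
    moreover have "m b \<le> e"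
    proof -
      have "emeasure lborel (U \<inter> {a..b}) \<le> ennreal e"
        using emeasure_mono[of "U \<inter> {a..b}" U lborel] mU Ub
        by (meson Int_lower1 le_less_trans less_imp_le sets_lborel)
      thus ?thesis unfolding m_def measure_def
        using \<open>e > 0\<close> by (intro enn2real_leI) auto
    qed
    moreover have "0 \<le> m a" by (simp add: m_def)
    ultimately have "g b - g a \<le> K * m b + e * (b - a)" and "K * m b \<le> K * e" and "0 \<le> K * m a"
      using \<open>K \<ge> 0\<close> by (auto simp: G_def algebra_simps intro: mult_left_mono)
       (smt (verit) mult_nonneg_nonneg)
    thus ?thesis by (simp add: algebra_simps)
  qed
  show ?thesis
  proof (rule ccontr)
    assume "\<not> ?thesis"
    hence p: "g b - g a > 0" by simp
    define c where "c = K + (b - a) + 1"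
    have "c > 0" using \<open>K \<ge> 0\<close> \<open>a \<le> b\<close> by (simp add: c_def)
    have "g b - g a \<le> (g b - g a) / (2 * c) * (K + (b - a))"
      using bound[of "(g b - g a) / (2 * c)"] p \<open>c > 0\<close> by simp
    also have "\<dots> \<le> (g b - g a) / (2 * c) * c"
      using p \<open>c > 0\<close> by (intro mult_left_mono) (auto simp: c_def)
    also have "\<dots> = (g b - g a) / 2" using \<open>c > 0\<close> by simp
    finally show False using p by simp
  qed
qed

section \<open>Bounded martingale differences over windows of bounded length\<close>

text \<open>Comparison of the two power series: \<open>(2 n)! \<ge> 2 ^ n n!\<close>.\<close>

lemma cosh_le_exp_half_square: "cosh (x::real) \<le> exp (x\<^sup>2 / 2)"
proof -
  have fact_ge: "2 ^ n * fact n \<le> (fact (2 * n) :: real)" for n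
  proof (induction n)
    case (Suc n)
    have "2 ^ Suc n * fact (Suc n) = real (2 * n + 2) * (2 ^ n * fact n)"
      by (simp add: algebra_simps)
    also have "\<dots> \<le> real (2 * n + 2) * fact (2 * n)" using Suc by (intro mult_left_mono) auto
    also have "\<dots> \<le> real (2 * n + 2) * (real (2 * n + 1) * fact (2 * n))"
      by (intro mult_left_mono) auto
    also have "\<dots> = fact (2 * Suc n)" by (simp add: algebra_simps)
    finally show ?case .
  qed simp
  have "(\<lambda>n. x ^ (2 * n) /\<^sub>R fact (2 * n)) sums cosh x"
    using sums_mono_reindex[of "\<lambda>n. 2 * n" "\<lambda>n. if even n then x ^ n /\<^sub>R fact n else 0" "cosh x"]
      cosh_converges[of x] by (simp add: strict_mono_def) (metis evenE rangeI)
  moreover have "(\<lambda>n. (x\<^sup>2 / 2) ^ n /\<^sub>R fact n) sums exp (x\<^sup>2 / 2)"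
    by (rule exp_converges)
  moreover have "x ^ (2 * n) /\<^sub>R fact (2 * n) \<le> (x\<^sup>2 / 2) ^ n /\<^sub>R fact n" for n
  proof -
    have "x ^ (2 * n) / fact (2 * n) \<le> x ^ (2 * n) / (2 ^ n * fact n)"
      using fact_ge[of n] by (intro divide_left_mono) auto
    thus ?thesis by (simp add: power_mult power_divide inverse_eq_divide mult.commute flip: power_mult)
  qed
  ultimately show ?thesis by (rule sums_le[rotated])
qed

text \<open>A convex function lies below its chord over \<open>[-C, C]\<close>. The bound is affine in \<open>x\<close>, so taking a
  conditional expectation of mean zero leaves only the \<open>cosh\<close> term: this is how Hoeffding's lemma enters.\<close>

lemma exp_le_chord:
  fixes x :: real
  assumes "\<bar>x\<bar> \<le> C" "C > 0"
  shows "exp (c * x) \<le> cosh (c * C) + x / C * sinh (c * C)"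
proof -
  define t where "t = (1 + x / C) / 2"
  have "0 \<le> t" "t \<le> 1" using assms by (auto simp: t_def field_simps)
  hence "exp ((1 - t) *\<^sub>R (- c * C) + t *\<^sub>R (c * C)) \<le> (1 - t) * exp (- c * C) + t * exp (c * C)"
    by (intro convex_onD[OF exp_convex]) auto
  also have "(1 - t) *\<^sub>R (- c * C) + t *\<^sub>R (c * C) = c * x"
    using assms by (simp add: t_def field_simps)
  also have "(1 - t) * exp (- c * C) + t * exp (c * C) = cosh (c * C) + x / C * sinh (c * C)"
    using assms by (simp add: t_def cosh_def sinh_def field_simps)
  finally show ?thesis .
qed

text \<open>A scalar bounded martingale difference sequence for an arbitrary filtration; the first term \<open>\<xi> 0\<close>
  is not centred, so windows start at index \<open>1\<close> or later.\<close>

locale bounded_real_mds = prob_space M for M :: "'w measure" +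
  fixes F :: "nat \<Rightarrow> 'w measure" and \<xi> :: "nat \<Rightarrow> 'w \<Rightarrow> real" and C :: real
  assumes subalg: "\<And>k. subalgebra M (F k)"
    and adapted: "\<And>i k. i \<le> k \<Longrightarrow> \<xi> i \<in> borel_measurable (F k)"
    and cond_exp_zero: "\<And>k. AE \<omega> in M. real_cond_exp M (F k) (\<xi> (Suc k)) \<omega> = 0"
    and C_pos: "C > 0"
    and bounded: "\<And>k. AE \<omega> in M. \<bar>\<xi> k \<omega>\<bar> \<le> C"
begin

lemma measurable_noise [measurable]: "\<xi> k \<in> borel_measurable M"
  using adapted[of k k] subalg[of k] by (auto intro: measurable_from_subalg)

lemma AE_sum_bounded: "AE \<omega> in M. \<bar>\<Sum>i\<in>I. c i * \<xi> i \<omega>\<bar> \<le> (\<Sum>i\<in>I. \<bar>c i\<bar> * C)"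
proof -
  have "AE \<omega> in M. \<forall>i. \<bar>\<xi> i \<omega>\<bar> \<le> C" using bounded by (simp add: AE_all_countable)
  thus ?thesis
  proof eventually_elim
    case (elim \<omega>)
    have "\<bar>\<Sum>i\<in>I. c i * \<xi> i \<omega>\<bar> \<le> (\<Sum>i\<in>I. \<bar>c i * \<xi> i \<omega>\<bar>)" by (rule sum_abs)
    also have "\<dots> \<le> (\<Sum>i\<in>I. \<bar>c i\<bar> * C)"
      using elim by (intro sum_mono) (auto simp: abs_mult intro!: mult_left_mono)
    finally show ?case .
  qed
qed

lemma integrable_exp_sum: "integrable M (\<lambda>\<omega>. exp (\<Sum>i\<in>I. c i * \<xi> i \<omega>))"
proof (rule integrable_const_bound)
  show "AE \<omega> in M. norm (exp (\<Sum>i\<in>I. c i * \<xi> i \<omega>)) \<le> exp (\<Sum>i\<in>I. \<bar>c i\<bar> * C)"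
    using AE_sum_bounded[of c I] by eventually_elim auto
qed measurable

text \<open>Azuma's argument. The exponential \<open>Y\<close> of the sum so far is measurable for the past, hence
  uncorrelated with the next term, and by \<open>exp_le_chord\<close> each new term multiplies the expectation by
  at most \<open>cosh (c m * C) \<le> exp ((c m * C)\<^sup>2 / 2)\<close>.\<close>

lemma mgf_bound:
  assumes "1 \<le> n" "n \<le> m"
  shows "(\<integral>\<omega>. exp (\<Sum>i=n..<m. c i * \<xi> i \<omega>) \<partial>M) \<le> exp (C\<^sup>2 / 2 * (\<Sum>i=n..<m. (c i)\<^sup>2))"
  using assms(2)
proof (induction m rule: dec_induct)
  case base
  show ?case by (simp add: prob_space)
next
  case (step m)
  obtain k where k: "m = Suc k" using step assms(1) by (cases m) auto
  define Y where "Y \<omega> = exp (\<Sum>i=n..<m. c i * \<xi> i \<omega>)" for \<omega>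
  have Y_meas: "Y \<in> borel_measurable (F k)"
    unfolding Y_def by (intro borel_measurable_exp[THEN measurable_compose_rev] borel_measurable_sum
        borel_measurable_times borel_measurable_const adapted) (auto simp: k)
  hence Y_measM [measurable]: "Y \<in> borel_measurable M"
    using subalg[of k] by (auto intro: measurable_from_subalg)
  have Y_int: "integrable M Y" unfolding Y_def by (rule integrable_exp_sum)
  have Y\<xi>_int: "integrable M (\<lambda>\<omega>. Y \<omega> * \<xi> m \<omega>)"
  proof (rule Bochner_Integration.integrable_bound[of M "\<lambda>\<omega>. C * Y \<omega>"])
    show "AE \<omega> in M. norm (Y \<omega> * \<xi> m \<omega>) \<le> norm (C * Y \<omega>)"
      using bounded[of m]
    proof eventually_elim
      case (elim \<omega>)
      show ?case using elim C_pos mult_right_mono[OF elim, of "Y \<omega>"]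
        by (simp add: Y_def abs_mult mult.commute)
    qed
  qed (use Y_int in auto)
  interpret Fk: finite_measure_subalgebra M "F k" by unfold_locales (rule subalg)
  have "(\<integral>\<omega>. Y \<omega> * \<xi> m \<omega> \<partial>M) = (\<integral>\<omega>. Y \<omega> * real_cond_exp M (F k) (\<xi> m) \<omega> \<partial>M)"
    by (rule Fk.real_cond_exp_intg(2)[symmetric]) (use Y\<xi>_int Y_meas in auto)
  also have "\<dots> = (\<integral>\<omega>. 0 \<partial>M)"
    by (rule integral_cong_AE) (use cond_exp_zero[of k] k in auto)
  finally have zero: "(\<integral>\<omega>. Y \<omega> * \<xi> m \<omega> \<partial>M) = 0" by simp
  have "(\<integral>\<omega>. exp (\<Sum>i=n..<Suc m. c i * \<xi> i \<omega>) \<partial>M) = (\<integral>\<omega>. Y \<omega> * exp (c m * \<xi> m \<omega>) \<partial>M)"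
    using step by (simp add: Y_def exp_add)
  also have "\<dots> \<le> (\<integral>\<omega>. cosh (c m * C) * Y \<omega> + sinh (c m * C) / C * (Y \<omega> * \<xi> m \<omega>) \<partial>M)"
  proof (rule integral_mono_AE)
    have "(\<lambda>\<omega>. exp (\<Sum>i=n..<Suc m. c i * \<xi> i \<omega>)) = (\<lambda>\<omega>. Y \<omega> * exp (c m * \<xi> m \<omega>))"
      using step by (simp add: Y_def exp_add)
    thus "integrable M (\<lambda>\<omega>. Y \<omega> * exp (c m * \<xi> m \<omega>))"
      using integrable_exp_sum[of c "{n..<Suc m}"] by simp
    show "AE \<omega> in M. Y \<omega> * exp (c m * \<xi> m \<omega>)
        \<le> cosh (c m * C) * Y \<omega> + sinh (c m * C) / C * (Y \<omega> * \<xi> m \<omega>)"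
      using bounded[of m]
    proof eventually_elim
      case (elim \<omega>)
      have "Y \<omega> * exp (c m * \<xi> m \<omega>) \<le> Y \<omega> * (cosh (c m * C) + \<xi> m \<omega> / C * sinh (c m * C))"
        using elim C_pos by (intro mult_left_mono exp_le_chord) (auto simp: Y_def)
      thus ?case by (simp add: algebra_simps)
    qed
  qed (use Y_int Y\<xi>_int in auto)
  also have "\<dots> = cosh (c m * C) * (\<integral>\<omega>. Y \<omega> \<partial>M)"
    using Y_int Y\<xi>_int zero by simp
  also have "\<dots> \<le> exp ((c m * C)\<^sup>2 / 2) * exp (C\<^sup>2 / 2 * (\<Sum>i=n..<m. (c i)\<^sup>2))"
    using step.IH unfolding Y_def by (intro mult_mono cosh_le_exp_half_square) auto
  also have "\<dots> = exp (C\<^sup>2 / 2 * (\<Sum>i=n..<Suc m. (c i)\<^sup>2))"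
    using step by (simp add: exp_add[symmetric] algebra_simps power_mult_distrib)
  finally show ?case .
qed

text \<open>Markov's inequality for \<open>exp (l * _)\<close>, applied to the sum and to its negative.\<close>

lemma tail_bound:
  assumes "1 \<le> n" "n \<le> m" "l > 0"
  shows "prob {\<omega> \<in> space M. \<bar>\<Sum>i=n..<m. c i * \<xi> i \<omega>\<bar> \<ge> \<epsilon>}
    \<le> 2 * exp (C\<^sup>2 / 2 * l\<^sup>2 * (\<Sum>i=n..<m. (c i)\<^sup>2) - l * \<epsilon>)"
proof -
  define B where "B = exp (C\<^sup>2 / 2 * l\<^sup>2 * (\<Sum>i=n..<m. (c i)\<^sup>2) - l * \<epsilon>)"
  define A where "A s = {\<omega> \<in> space M. exp (l * \<epsilon>) \<le> exp (\<Sum>i=n..<m. (s * l * c i) * \<xi> i \<omega>)}" for s :: real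
  have A_sets: "A s \<in> sets M" for s unfolding A_def by measurable
  have A_bound: "prob (A s) \<le> B" if "s\<^sup>2 = 1" for s
  proof -
    have "prob (A s) \<le> (\<integral>\<omega>. exp (\<Sum>i=n..<m. (s * l * c i) * \<xi> i \<omega>) \<partial>M) / exp (l * \<epsilon>)"
      unfolding A_def
      by (rule integral_Markov_inequality_measure[where A = "{}"]) (auto intro: integrable_exp_sum)
    also have "\<dots> \<le> exp (C\<^sup>2 / 2 * (\<Sum>i=n..<m. (s * l * c i)\<^sup>2)) / exp (l * \<epsilon>)"
      by (intro divide_right_mono mgf_bound assms) auto
    also have "\<dots> = B"
      using that by (simp add: B_def exp_diff power_mult_distrib sum_distrib_left mult_ac)
    finally show ?thesis .
  qed
  have "A s = {\<omega> \<in> space M. \<epsilon> \<le> s * (\<Sum>i=n..<m. c i * \<xi> i \<omega>)}" for s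
  proof -
    have "(\<Sum>i=n..<m. (s * l * c i) * \<xi> i \<omega>) = l * (s * (\<Sum>i=n..<m. c i * \<xi> i \<omega>))" for \<omega>
      by (simp add: sum_distrib_left mult_ac)
    thus ?thesis using \<open>l > 0\<close> by (simp add: A_def)
  qed
  hence "{\<omega> \<in> space M. \<bar>\<Sum>i=n..<m. c i * \<xi> i \<omega>\<bar> \<ge> \<epsilon>} \<subseteq> A 1 \<union> A (-1)"
    by auto
  hence "prob {\<omega> \<in> space M. \<bar>\<Sum>i=n..<m. c i * \<xi> i \<omega>\<bar> \<ge> \<epsilon>} \<le> prob (A 1 \<union> A (-1))"
    using A_sets by (intro finite_measure_mono) auto
  also have "\<dots> \<le> prob (A 1) + prob (A (-1))" using A_sets by (intro measure_Un_le)
  also have "\<dots> \<le> B + B" by (intro add_mono A_bound) auto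
  finally show ?thesis by (simp add: B_def)
qed

text \<open>For every \<open>n\<close> only one window \<open>[n, w n)\<close> is considered, so a tail bound summable in \<open>n\<close> suffices and
  no union over the right end is taken. The variance proxy of the window is at most \<open>T\<close> times the
  largest step size beyond \<open>n\<close>, which is \<open>o(1 / ln n)\<close>; choosing \<open>l\<close> proportional to \<open>ln n\<close> turns
  \<open>tail_bound\<close> into \<open>2 / n\<^sup>2\<close>, and Borel--Cantelli applies.\<close>

lemma window_noise_tendsto_0:
  fixes \<eta> :: "nat \<Rightarrow> real"
  assumes "\<And>k. 0 < \<eta> k" and small: "\<eta> \<in> o(\<lambda>k. 1 / ln (real k))"
    and w: "\<And>n. n \<le> w n" and window: "\<forall>\<^sub>F n in sequentially. (\<Sum>i=n..<w n. \<eta> i) \<le> T"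
  shows "AE \<omega> in M. (\<lambda>n. \<Sum>i=n..<w n. \<eta> i * \<xi> i \<omega>) \<longlonglongrightarrow> 0"
proof -
  define A where "A q n = {\<omega> \<in> space M. \<bar>\<Sum>i=n..<w n. \<eta> i * \<xi> i \<omega>\<bar> \<ge> 1 / real (Suc q)}" for q n
  have A_sets: "A q n \<in> sets M" for q n unfolding A_def by measurable
  have ev: "AE \<omega> in M. \<forall>\<^sub>F n in sequentially. \<omega> \<in> space M - A q n" for q
  proof (rule borel_cantelli_AE1)
    define \<epsilon> where "\<epsilon> = 1 / real (Suc q)"
    have "\<epsilon> > 0" by (simp add: \<epsilon>_def)
    define T' where "T' = \<bar>T\<bar> + 1"
    have "T' > 0" by (simp add: T'_def)
    \<comment> \<open>With this constant, the bound on the exponent for \<open>l = 3 ln n / \<epsilon>\<close> is exactly \<open>-2 ln n\<close>.\<close>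
    define \<kappa> where "\<kappa> = 2 * \<epsilon>\<^sup>2 / (9 * C\<^sup>2 * T')"
    have "\<kappa> > 0" using \<open>\<epsilon> > 0\<close> \<open>T' > 0\<close> C_pos by (simp add: \<kappa>_def)
    have "\<forall>\<^sub>F k in sequentially. norm (\<eta> k) \<le> \<kappa> * norm (1 / ln (real k))"
      using small \<open>\<kappa> > 0\<close> by (rule landau_o.smallD)
    then obtain N0 where N0: "\<And>k. k \<ge> N0 \<Longrightarrow> norm (\<eta> k) \<le> \<kappa> * norm (1 / ln (real k))"
      by (auto simp: eventually_sequentially)
    have "\<forall>\<^sub>F n in sequentially. norm (prob (A q n)) \<le> 2 * (1 / real n ^ 2)"
      using window eventually_ge_at_top[of "max 3 N0"]
    proof eventually_elim
      case (elim n)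
      hence n: "n \<ge> 3" "n \<ge> N0" by auto
      define l where "l = 3 * ln (real n) / \<epsilon>"
      have ln: "ln (real n) > 0" using n by simp
      hence "l > 0" using \<open>\<epsilon> > 0\<close> by (simp add: l_def)
      have "\<eta> i \<le> \<kappa> / ln (real n)" if "i \<ge> n" for i
      proof -
        have "\<eta> i \<le> \<kappa> / ln (real i)"
          using N0[of i] that n assms(1)[of i] by (auto simp: abs_of_pos)
        also have "\<dots> \<le> \<kappa> / ln (real n)"
          using that n ln \<open>\<kappa> > 0\<close> by (intro divide_left_mono) auto
        finally show ?thesis .
      qed
      hence "(\<Sum>i=n..<w n. (\<eta> i)\<^sup>2) \<le> (\<Sum>i=n..<w n. \<kappa> / ln (real n) * \<eta> i)"
        using assms(1) by (intro sum_mono) (auto simp: power2_eq_square less_imp_le simp del: times_divide_eq_left intro!: mult_right_mono)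
      also have "\<dots> = \<kappa> / ln (real n) * (\<Sum>i=n..<w n. \<eta> i)" by (simp add: sum_distrib_left)
      also have "\<dots> \<le> \<kappa> / ln (real n) * T'"
        using elim \<open>\<kappa> > 0\<close> ln by (intro mult_left_mono) (auto simp: T'_def)
      finally have V: "(\<Sum>i=n..<w n. (\<eta> i)\<^sup>2) \<le> \<kappa> / ln (real n) * T'" .
      have "prob (A q n) \<le> 2 * exp (C\<^sup>2 / 2 * l\<^sup>2 * (\<Sum>i=n..<w n. (\<eta> i)\<^sup>2) - l * \<epsilon>)"
        unfolding A_def \<epsilon>_def using n w \<open>l > 0\<close> by (intro tail_bound) auto
      also have "C\<^sup>2 / 2 * l\<^sup>2 * (\<Sum>i=n..<w n. (\<eta> i)\<^sup>2) - l * \<epsilon>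
          \<le> C\<^sup>2 / 2 * l\<^sup>2 * (\<kappa> / ln (real n) * T') - l * \<epsilon>"
        using V by (intro diff_right_mono mult_left_mono) auto
      also have "\<dots> = - 2 * ln (real n)"
        using ln \<open>\<epsilon> > 0\<close> \<open>T' > 0\<close> C_pos
        by (simp add: l_def \<kappa>_def field_simps power2_eq_square)
      also have "exp (- 2 * ln (real n)) = 1 / real n ^ 2"
        using n powr_realpow[of "real n" 2] by (simp add: exp_minus powr_def inverse_eq_divide)
      finally show ?case by simp
    qed
    moreover have "summable (\<lambda>n. 2 * (1 / real n ^ 2))"
      by (intro summable_mult inverse_power_summable[of 2, where 'a = real, unfolded inverse_eq_divide]) auto
    ultimately show "summable (\<lambda>n. prob (A q n))"
      by (rule summable_comparison_test_ev)
  qed (use A_sets emeasure_finite in \<open>auto simp: less_top[symmetric]\<close>)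
  hence "AE \<omega> in M. \<forall>q. \<forall>\<^sub>F n in sequentially. \<omega> \<in> space M - A q n"
    by (simp add: AE_all_countable)
  thus ?thesis
  proof eventually_elim
    case (elim \<omega>)
    show ?case
    proof (rule tendstoI)
      fix e :: real assume "e > 0"
      then obtain q where q: "1 / real (Suc q) < e" using nat_approx_posE by blast
      from elim have "\<forall>\<^sub>F n in sequentially. \<omega> \<in> space M - A q n" by blast
      thus "\<forall>\<^sub>F n in sequentially. dist (\<Sum>i=n..<w n. \<eta> i * \<xi> i \<omega>) 0 < e"
        by eventually_elim (use q in \<open>auto simp: A_def\<close>)
    qed
  qed
qed

end

lemma subalgebra_natural_filtration:
  assumes "\<And>k. \<xi> k \<in> borel_measurable M"
  shows "subalgebra M (natural_filtration M \<xi> k)"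
proof -
  have gen: "(\<Union>i\<le>k. {\<xi> i -` A \<inter> space M | A. A \<in> sets borel}) \<subseteq> sets M"
    using assms by (auto intro: measurable_sets)
  hence "sigma_sets (space M) (\<Union>i\<le>k. {\<xi> i -` A \<inter> space M | A. A \<in> sets borel}) \<subseteq> sets M"
    by (rule sets.sigma_sets_subset)
  moreover have "(\<Union>i\<le>k. {\<xi> i -` A \<inter> space M | A. A \<in> sets borel}) \<subseteq> Pow (space M)"
    by auto
  ultimately show ?thesis
    unfolding subalgebra_def natural_filtration_def
    by (simp only: sets_measure_of space_measure_of)
qed

lemma measurable_natural_filtration:
  fixes \<xi> :: "nat \<Rightarrow> 'w \<Rightarrow> 'a::topological_space"
  assumes "\<And>k. \<xi> k \<in> borel_measurable M" "i \<le> k"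
  shows "\<xi> i \<in> borel_measurable (natural_filtration M \<xi> k)"
proof (rule measurableI)
  have gen: "(\<Union>i\<le>k. {\<xi> i -` A \<inter> space M | A. A \<in> sets borel}) \<subseteq> Pow (space M)"
    by auto
  have sp: "space (natural_filtration M \<xi> k) = space M"
    unfolding natural_filtration_def by (rule space_measure_of) (rule gen)
  fix A :: "'a set" assume "A \<in> sets borel"
  thus "\<xi> i -` A \<inter> space (natural_filtration M \<xi> k) \<in> sets (natural_filtration M \<xi> k)"
    unfolding sp unfolding natural_filtration_def sets_measure_of[OF gen]
    using assms(2) by (intro sigma_sets.Basic) auto
qed auto

lemma window_noise_tendsto_0_vector:
  fixes \<xi> :: "nat \<Rightarrow> 'w \<Rightarrow> 'a::euclidean_space" and \<eta> :: "nat \<Rightarrow> real"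
  assumes "prob_space M" and mds: "bounded_martingale_difference M \<xi>"
    and "\<And>k. 0 < \<eta> k" and "\<eta> \<in> o(\<lambda>k. 1 / ln (real k))"
    and "\<And>n. n \<le> w n" and "\<forall>\<^sub>F n in sequentially. (\<Sum>i=n..<w n. \<eta> i) \<le> T"
  shows "AE \<omega> in M. (\<lambda>n. \<Sum>i=n..<w n. \<eta> i *\<^sub>R \<xi> i \<omega>) \<longlonglongrightarrow> 0"
proof -
  interpret prob_space M by fact
  from mds obtain C where meas: "\<And>k. \<xi> k \<in> borel_measurable M"
    and cond: "\<And>k b. b \<in> Basis \<Longrightarrow>
      AE \<omega> in M. real_cond_exp M (natural_filtration M \<xi> k) (\<lambda>w. \<xi> (Suc k) w \<bullet> b) \<omega> = 0"
    and C: "\<And>k. AE \<omega> in M. norm (\<xi> k \<omega>) \<le> C"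
    unfolding bounded_martingale_difference_def by blast
  have "AE \<omega> in M. (\<lambda>n. \<Sum>i=n..<w n. \<eta> i * (\<xi> i \<omega> \<bullet> b)) \<longlonglongrightarrow> 0" if b: "b \<in> Basis" for b
  proof -
    interpret bounded_real_mds M "natural_filtration M \<xi>" "\<lambda>k \<omega>. \<xi> k \<omega> \<bullet> b" "\<bar>C\<bar> + 1"
    proof
      show "subalgebra M (natural_filtration M \<xi> k)" for k
        by (rule subalgebra_natural_filtration[OF meas])
      show "(\<lambda>\<omega>. \<xi> i \<omega> \<bullet> b) \<in> borel_measurable (natural_filtration M \<xi> k)" if "i \<le> k" for i k
        using measurable_natural_filtration[of \<xi> M, OF meas that] by measurable
      show "AE \<omega> in M. \<bar>\<xi> k \<omega> \<bullet> b\<bar> \<le> \<bar>C\<bar> + 1" for k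
        using C[of k]
      proof eventually_elim
        case (elim \<omega>)
        have "\<bar>\<xi> k \<omega> \<bullet> b\<bar> \<le> norm (\<xi> k \<omega>)" using b by (rule Basis_le_norm)
        thus ?case using elim by linarith
      qed
    qed (use cond b in auto)
    show ?thesis by (rule window_noise_tendsto_0) fact+
  qed
  hence "AE \<omega> in M. \<forall>b\<in>Basis. (\<lambda>n. \<Sum>i=n..<w n. \<eta> i * (\<xi> i \<omega> \<bullet> b)) \<longlonglongrightarrow> 0"
    by (intro AE_finite_allI) auto
  thus ?thesis
    by eventually_elim
      (subst tendsto_componentwise_iff, simp add: inner_sum_left)
qed

section \<open>Bregman distances and the length of a step\<close>

lemma GDERIV_gradient:
  fixes \<phi> :: "'a::euclidean_space \<Rightarrow> real"
  assumes "\<phi> differentiable (at x)"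
  shows "GDERIV \<phi> x :> gradient \<phi> x"
proof -
  from assms obtain f' where f': "(\<phi> has_derivative f') (at x)" by (auto simp: differentiable_def)
  interpret bounded_linear f' by (rule has_derivative_bounded_linear[OF f'])
  define g where "g = (\<Sum>b\<in>Basis. f' b *\<^sub>R b)"
  have "f' v = v \<bullet> g" for v
  proof -
    have "f' v = f' (\<Sum>b\<in>Basis. (v \<bullet> b) *\<^sub>R b)" by (simp add: euclidean_representation)
    also have "\<dots> = (\<Sum>b\<in>Basis. (v \<bullet> b) * f' b)" by (simp add: sum scaleR)
    also have "\<dots> = v \<bullet> g" by (simp add: g_def inner_sum_right mult.commute)
    finally show ?thesis .
  qed
  hence *: "GDERIV \<phi> x :> g" using f' unfolding gderiv_def by presburger
  moreover have "g' = g" if "GDERIV \<phi> x :> g'" for g'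
  proof -
    have "(\<lambda>v. v \<bullet> g') = (\<lambda>v. v \<bullet> g)"
      using that * has_derivative_unique unfolding gderiv_def by blast
    thus ?thesis by (metis inner_commute vector_eq_rdot)
  qed
  ultimately show ?thesis unfolding gradient_def by (rule theI)
qed

text \<open>The one-dimensional tangent inequality on the line through \<open>x\<close> and \<open>y\<close>.\<close>

lemma convex_on_above_gradient_tangent:
  fixes \<psi> :: "'a::real_inner \<Rightarrow> real"
  assumes \<psi>: "convex_on S \<psi>" and "open S" and x: "x \<in> S" and y: "y \<in> S"
    and g: "GDERIV \<psi> y :> g"
  shows "\<psi> y + g \<bullet> (x - y) \<le> \<psi> x"
proof -
  define p where "p t = y + t *\<^sub>R (x - y)" for t :: real
  define A where "A = p -` S"
  have p_comb: "p (u * s + v * t) = u *\<^sub>R p s + v *\<^sub>R p t" if "u + v = 1" for u v s t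
  proof -
    have "u *\<^sub>R p s + v *\<^sub>R p t = (u + v) *\<^sub>R y + (u * s + v * t) *\<^sub>R (x - y)"
      unfolding p_def by (simp add: algebra_simps)
    thus ?thesis using that by (simp add: p_def)
  qed
  have "convex S" using \<psi> by (simp add: convex_on_def)
  have "convex A"
    using \<open>convex S\<close> unfolding convex_def A_def by (auto simp: p_comb)
  moreover have "\<psi> (p (u * s + v * t)) \<le> u * \<psi> (p s) + v * \<psi> (p t)"
    if "s \<in> A" "t \<in> A" "u \<ge> 0" "v \<ge> 0" "u + v = 1" for s t u v
    unfolding p_comb[OF that(5)] using \<psi> that unfolding convex_on_def A_def by auto
  ultimately have "convex_on A (\<lambda>t. \<psi> (p t))" "convex A" by (auto simp: convex_on_def)
  moreover have "continuous_on UNIV p" unfolding p_def by (intro continuous_intros)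
  hence "open A" unfolding A_def using \<open>open S\<close> by (rule open_vimage[rotated])
  moreover have "0 \<in> A" "1 \<in> A" using x y by (auto simp: A_def p_def)
  moreover have "((\<lambda>t. \<psi> (p t)) has_field_derivative g \<bullet> (x - y)) (at 0 within A)"
  proof -
    have "(p has_derivative (\<lambda>t. t *\<^sub>R (x - y))) (at 0 within A)"
      unfolding p_def by (auto intro!: derivative_eq_intros)
    moreover have "(\<psi> has_derivative (\<lambda>v. v \<bullet> g)) (at (p 0))"
      using g by (simp add: gderiv_def p_def)
    ultimately have "((\<lambda>t. \<psi> (p t)) has_derivative (\<lambda>t. (t *\<^sub>R (x - y)) \<bullet> g)) (at 0 within A)"
      by (rule has_derivative_compose)
    moreover have "(\<lambda>t. (t *\<^sub>R (x - y)) \<bullet> g) = (*) (g \<bullet> (x - y))"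
      by (simp add: fun_eq_iff inner_commute)
    ultimately show ?thesis unfolding has_field_derivative_def by simp
  qed
  ultimately have "\<psi> (p 1) - \<psi> (p 0) \<ge> (g \<bullet> (x - y)) * (1 - 0)"
    by (intro convex_on_imp_above_tangent[of A]) (auto simp: interior_open intro: convex_connected)
  thus ?thesis by (simp add: p_def)
qed

text \<open>The tangent inequality for \<open>\<phi> - \<mu> / 2 * norm\<^sup>2\<close>, rearranged.\<close>

lemma bregman_ge_if_strongly_convex:
  fixes \<phi> :: "'a::euclidean_space \<Rightarrow> real"
  assumes "convex_on (ball p r) (\<lambda>y. \<phi> y - \<mu> / 2 * (norm y)\<^sup>2)"
    and "\<phi> differentiable (at y)" and "x \<in> ball p r" "y \<in> ball p r"
  shows "\<mu> / 2 * (norm (x - y))\<^sup>2 \<le> bregman \<phi> x y"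
proof -
  have "((\<lambda>y. \<phi> y - \<mu> / 2 * (y \<bullet> y)) has_derivative
      (\<lambda>v. v \<bullet> gradient \<phi> y - \<mu> / 2 * (y \<bullet> v + v \<bullet> y))) (at y)"
    using GDERIV_gradient[OF assms(2)] unfolding gderiv_def
    by (auto intro!: derivative_eq_intros)
  hence "GDERIV (\<lambda>y. \<phi> y - \<mu> / 2 * (norm y)\<^sup>2) y :> gradient \<phi> y - \<mu> *\<^sub>R y"
    unfolding gderiv_def by (simp add: power2_norm_eq_inner inner_diff_right inner_commute)
  from convex_on_above_gradient_tangent[OF assms(1) open_ball assms(3,4) this]
  show ?thesis
    by (simp add: bregman_def power2_norm_eq_inner inner_diff_left inner_diff_right inner_commute field_simps)
qed

lemma convex_on_if_strictly_convex:
  assumes "strictly_convex \<phi>" shows "convex_on UNIV \<phi>"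
proof (rule convex_onI)
  fix t :: real and x y :: 'a assume "0 < t" "t < 1"
  thus "\<phi> ((1 - t) *\<^sub>R x + t *\<^sub>R y) \<le> (1 - t) * \<phi> x + t * \<phi> y"
    using assms by (cases "x = y") (auto simp: strictly_convex_def algebra_simps less_imp_le)
qed auto

text \<open>Far from \<open>y\<close> no local information is available, but \<open>bregman \<phi> _ y\<close> is convex and vanishes at
  \<open>y\<close>: it dominates its value at the point of the segment at distance \<open>r / 2\<close> from \<open>y\<close>. This is what
  forces the iterates to move by less than \<open>r\<close> once the step sizes are small.\<close>

lemma bregman_ge_far:
  fixes \<phi> :: "'a::euclidean_space \<Rightarrow> real"
  assumes "convex_on UNIV \<phi>" and "0 < r" and "r \<le> norm (x - y)" and "0 \<le> \<mu>"
    and near: "\<And>z. norm (z - y) < r \<Longrightarrow> \<mu> / 2 * (norm (z - y))\<^sup>2 \<le> bregman \<phi> z y"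
  shows "\<mu> / 8 * r\<^sup>2 \<le> bregman \<phi> x y"
proof -
  define s where "s = r / (2 * norm (x - y))"
  define z where "z = (1 - s) *\<^sub>R y + s *\<^sub>R x"
  have s: "0 < s" "s \<le> 1" using assms(2) order.strict_trans2[OF assms(2,3)] assms(3) by (auto simp: s_def field_simps)
  have z: "z - y = s *\<^sub>R (x - y)" by (simp add: z_def algebra_simps)
  hence nz: "norm (z - y) = r / 2" using assms s by (auto simp: s_def)
  have "\<phi> z \<le> (1 - s) * \<phi> y + s * \<phi> x"
    unfolding z_def using s by (intro convex_onD[OF assms(1)]) auto
  hence "bregman \<phi> z y \<le> s * bregman \<phi> x y"
    unfolding bregman_def z by (simp add: algebra_simps)
  moreover have "\<mu> / 8 * r\<^sup>2 \<le> bregman \<phi> z y"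
    using near[of z] nz \<open>0 < r\<close> by (simp add: power_divide)
  ultimately have *: "\<mu> / 8 * r\<^sup>2 \<le> s * bregman \<phi> x y" by simp
  moreover have "0 \<le> \<mu> / 8 * r\<^sup>2" using assms by simp
  ultimately have "0 \<le> s * bregman \<phi> x y" by (rule order_trans[rotated])
  hence "0 \<le> bregman \<phi> x y" using s by (simp add: zero_le_mult_iff)
  hence "s * bregman \<phi> x y \<le> bregman \<phi> x y" using s mult_right_mono[of s 1 "bregman \<phi> x y"] by simp
  with * show ?thesis by simp
qed

text \<open>A property of pairs that holds locally, with a constant depending on the place, holds with one
  constant for all pairs of nearby points close to a compact set: otherwise there is a sequence of
  bad pairs, and it fails at a cluster point.\<close>

lemma compact_uniform_near_diagonal:
  fixes P :: "nat \<Rightarrow> 'a::metric_space \<Rightarrow> 'a \<Rightarrow> bool"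
  assumes "compact K"
    and loc: "\<And>p. p \<in> K \<Longrightarrow> \<exists>r>0. \<exists>c. \<forall>x\<in>ball p r. \<forall>y\<in>ball p r. P c x y"
    and mono: "\<And>c c' x y. c \<le> c' \<Longrightarrow> P c x y \<Longrightarrow> P c' x y"
  obtains r c where "r > 0" "\<And>x y. y \<in> K \<Longrightarrow> dist x y < r \<Longrightarrow> P c x y"
proof -
  have "\<exists>n. \<forall>x y. y \<in> K \<longrightarrow> dist x y < inverse (real (Suc n)) \<longrightarrow> P n x y"
  proof (rule ccontr)
    assume "\<not> ?thesis"
    then obtain x y where xy: "\<And>n. y n \<in> K" "\<And>n. dist (x n) (y n) < inverse (real (Suc n))"
        "\<And>n. \<not> P n (x n) (y n)"
      by metis
    obtain p s where p: "p \<in> K" "strict_mono s" "(y \<circ> s) \<longlonglongrightarrow> p"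
      using \<open>compact K\<close> xy(1) unfolding compact_def by metis
    obtain r c where r: "r > 0" "\<And>x y. x \<in> ball p r \<Longrightarrow> y \<in> ball p r \<Longrightarrow> P c x y"
      using loc[OF p(1)] by blast
    have "(\<lambda>n. dist (x n) (y n)) \<longlonglongrightarrow> 0"
      by (rule tendsto_sandwich[OF _ _ tendsto_const LIMSEQ_inverse_real_of_nat])
        (use xy(2) in \<open>auto intro!: always_eventually less_imp_le simp del: of_nat_Suc\<close>)
    hence "(\<lambda>n. dist (x (s n)) (y (s n))) \<longlonglongrightarrow> 0"
      using LIMSEQ_subseq_LIMSEQ[OF _ p(2)] by (fastforce simp: o_def)
    moreover have "(\<lambda>n. dist p (y (s n))) \<longlonglongrightarrow> 0"
      using tendsto_dist[OF tendsto_const[of p] p(3)] by (simp add: o_def)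
    ultimately have "\<forall>\<^sub>F n in sequentially. dist (x (s n)) (y (s n)) < r / 2 \<and> dist p (y (s n)) < r / 2 \<and> n \<ge> c"
      using \<open>r > 0\<close> by (intro eventually_conj eventually_ge_at_top) (auto dest!: order_tendstoD(2)[of _ 0 _ "r / 2"])
    then obtain n where n: "dist (x (s n)) (y (s n)) < r / 2" "dist p (y (s n)) < r / 2" "n \<ge> c"
      by (auto simp: eventually_sequentially)
    have "dist p (x (s n)) < r"
      using n dist_triangle[of p "x (s n)" "y (s n)"] by (simp add: dist_commute)
    hence "P c (x (s n)) (y (s n))" using n \<open>r > 0\<close> by (intro r(2)) auto
    moreover have "c \<le> s n" using n(3) seq_suble[OF p(2), of n] by simp
    ultimately show False using xy(3) mono by blast
  qed
  then obtain n where "\<And>x y. y \<in> K \<Longrightarrow> dist x y < inverse (real (Suc n)) \<Longrightarrow> P n x y" by blast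
  thus ?thesis by (intro that[of "inverse (real (Suc n))"]) auto
qed

lemma locally_lipschitz_near_compact:
  assumes "locally_lipschitz g" "compact K"
  obtains r L where "r > 0" "L \<ge> 0" "\<And>x y. y \<in> K \<Longrightarrow> dist x y < r \<Longrightarrow> dist (g x) (g y) \<le> L * dist x y"
proof -
  have "\<exists>r>0. \<exists>c::nat. \<forall>x\<in>ball p r. \<forall>y\<in>ball p r. dist (g x) (g y) \<le> real c * dist x y" for p
  proof -
    obtain r L where r: "r > 0" "L-lipschitz_on (ball p r) g"
      using assms(1) unfolding locally_lipschitz_def by blast
    obtain c :: nat where "L \<le> real c" using real_arch_simple by blast
    hence "dist (g x) (g y) \<le> real c * dist x y" if "x \<in> ball p r" "y \<in> ball p r" for x y
      using lipschitz_onD[OF r(2) that] mult_right_mono[of L "real c" "dist x y"] by simp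
    thus ?thesis using r by blast
  qed
  then obtain r and c :: nat where "r > 0" "\<And>x y. y \<in> K \<Longrightarrow> dist x y < r \<Longrightarrow> dist (g x) (g y) \<le> real c * dist x y"
    by (rule compact_uniform_near_diagonal[OF \<open>compact K\<close>, of "\<lambda>c x y. dist (g x) (g y) \<le> real c * dist x y"])
      (auto elim!: order_trans intro!: mult_right_mono)
  thus ?thesis by (intro that[of r "real c"]) auto
qed

lemma locally_lipschitz_imp_continuous_on:
  assumes "locally_lipschitz g" shows "continuous_on UNIV g"
proof -
  have "isCont g x" for x
  proof -
    obtain r L where "r > 0" "L-lipschitz_on (ball x r) g"
      using assms unfolding locally_lipschitz_def by blast
    thus ?thesis
      by (meson centre_in_ball continuous_on_eq_continuous_at lipschitz_on_continuous_on open_ball)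
  qed
  thus ?thesis by (simp add: continuous_at_imp_continuous_on)
qed

lemma bregman_ge_near_compact:
  fixes \<phi> :: "'a::euclidean_space \<Rightarrow> real"
  assumes "locally_strongly_convex \<phi>" "\<And>x. \<phi> differentiable (at x)" "compact K"
  obtains r \<mu> where "r > 0" "\<mu> > 0"
    "\<And>x y. y \<in> K \<Longrightarrow> dist x y < r \<Longrightarrow> \<mu> / 2 * (norm (x - y))\<^sup>2 \<le> bregman \<phi> x y"
proof -
  define P where "P c x y \<longleftrightarrow> inverse (real (Suc c)) / 2 * (norm (x - y))\<^sup>2 \<le> bregman \<phi> x y"
    for c x y
  have weaken: "\<mu>' / 2 * (norm (x - y))\<^sup>2 \<le> bregman \<phi> x y"
    if "\<mu>' \<le> \<mu>" "\<mu> / 2 * (norm (x - y))\<^sup>2 \<le> bregman \<phi> x y" for \<mu> \<mu>' :: real and x y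
    using that mult_right_mono[of "\<mu>' / 2" "\<mu> / 2" "(norm (x - y))\<^sup>2"] by auto
  have "\<exists>r>0. \<exists>c. \<forall>x\<in>ball p r. \<forall>y\<in>ball p r. P c x y" for p
  proof -
    obtain r \<mu> where r: "r > 0" "\<mu> > 0" "convex_on (ball p r) (\<lambda>y. \<phi> y - \<mu> / 2 * (norm y)\<^sup>2)"
      using assms(1) unfolding locally_strongly_convex_def by blast
    obtain c where "inverse (real (Suc c)) < \<mu>" using reals_Archimedean[OF r(2)] by blast
    thus ?thesis
      using r bregman_ge_if_strongly_convex[OF r(3) assms(2)] weaken unfolding P_def
      by (meson less_imp_le)
  qed
  moreover have "P c' x y" if "c \<le> c'" "P c x y" for c c' x y
    using that(2) unfolding P_def by (rule weaken[rotated]) (use that(1) in \<open>simp add: field_simps\<close>)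
  ultimately obtain r c where "r > 0" "\<And>x y. y \<in> K \<Longrightarrow> dist x y < r \<Longrightarrow> P c x y"
    using compact_uniform_near_diagonal[OF \<open>compact K\<close>, of P] by blast
  thus ?thesis by (intro that[of r "inverse (real (Suc c))"]) (auto simp: P_def)
qed

lemma eventually_le_imp_le_multiple:
  fixes a \<eta> :: "nat \<Rightarrow> real"
  assumes \<eta>: "\<And>k. 0 < \<eta> k" and ev: "\<forall>\<^sub>F k in sequentially. a k \<le> C * \<eta> k"
  obtains C' where "C' \<ge> 0" "\<And>k. a k \<le> C' * \<eta> k"
proof -
  obtain N where N: "\<And>k. k \<ge> N \<Longrightarrow> a k \<le> C * \<eta> k"
    using ev unfolding eventually_sequentially by blast
  define C' where "C' = \<bar>C\<bar> + (\<Sum>k<N. \<bar>a k\<bar> / \<eta> k)"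
  have nonneg: "0 \<le> \<bar>a k\<bar> / \<eta> k" for k using \<eta>[of k] by simp
  have "a k \<le> C' * \<eta> k" for k
  proof (cases "k < N")
    case True
    hence "\<bar>a k\<bar> / \<eta> k \<le> (\<Sum>k<N. \<bar>a k\<bar> / \<eta> k)"
      using nonneg by (intro member_le_sum) auto
    hence "\<bar>a k\<bar> / \<eta> k \<le> C'" by (simp add: C'_def)
    hence "\<bar>a k\<bar> \<le> C' * \<eta> k" using \<eta>[of k] by (simp add: divide_le_eq)
    thus ?thesis by linarith
  next
    case False
    have "C \<le> C'" using sum_nonneg[of "{..<N}" "\<lambda>k. \<bar>a k\<bar> / \<eta> k"] nonneg unfolding C'_def by fastforce
    hence "C * \<eta> k \<le> C' * \<eta> k" using \<eta>[of k] by (intro mult_right_mono) auto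
    thus ?thesis using N[of k] False by simp
  qed
  moreover have "C' \<ge> 0" unfolding C'_def using nonneg by (intro add_nonneg_nonneg sum_nonneg) auto
  ultimately show ?thesis by (rule that[rotated])
qed

text \<open>The descent condition bounds the Bregman distance of consecutive iterates by \<open>\<eta> k\<close> times a constant, so
  by \<open>bregman_ge_far\<close> consecutive iterates are eventually close. Local strong convexity then bounds the
  squared step from below and local Lipschitz continuity of \<open>R\<close> bounds the right-hand side linearly in the
  step; dividing by the step gives the claim.\<close>

lemma step_size_bound:
  fixes \<phi> R :: "'a::euclidean_space \<Rightarrow> real" and x g :: "nat \<Rightarrow> 'a"
  assumes \<phi>: "convex_on UNIV \<phi>" "locally_strongly_convex \<phi>" "\<And>x. \<phi> differentiable (at x)"
    and R: "locally_lipschitz R"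
    and x: "bounded (range x)" and g: "\<And>k. norm (g k) \<le> G"
    and \<eta>: "\<And>k. 0 < \<eta> k" "\<eta> \<longlonglongrightarrow> 0"
    and descent: "\<And>k. g k \<bullet> (x (Suc k) - x k) + 1 / \<eta> k * bregman \<phi> (x (Suc k)) (x k) + R (x (Suc k))
          \<le> R (x k)"
  obtains C where "C \<ge> 0" "\<And>k. norm (x (Suc k) - x k) \<le> C * \<eta> k"
proof -
  define K where "K = closure (range x)"
  have K: "compact K" unfolding K_def using x by simp
  have xK: "x k \<in> K" for k unfolding K_def by (meson closure_subset rangeI subsetD)
  define \<Delta> where "\<Delta> k = norm (x (Suc k) - x k)" for k
  obtain rR L where rR: "rR > 0" "L \<ge> 0" "\<And>u v. v \<in> K \<Longrightarrow> dist u v < rR \<Longrightarrow> dist (R u) (R v) \<le> L * dist u v"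
    using locally_lipschitz_near_compact[OF R K] by blast
  obtain r\<phi> \<mu> where r\<phi>: "r\<phi> > 0" "\<mu> > 0"
      "\<And>u v. v \<in> K \<Longrightarrow> dist u v < r\<phi> \<Longrightarrow> \<mu> / 2 * (norm (u - v))\<^sup>2 \<le> bregman \<phi> u v"
    using bregman_ge_near_compact[OF \<phi>(2,3) K] by blast
  define r where "r = min rR r\<phi>"
  have "r > 0" using rR r\<phi> by (simp add: r_def)
  have "G \<ge> 0" using g[of 0] norm_ge_zero order_trans by blast
  have "compact (R ` K)"
    by (intro compact_continuous_image K continuous_on_subset[OF locally_lipschitz_imp_continuous_on[OF R]]) auto
  then obtain BR where BR: "\<And>v. v \<in> K \<Longrightarrow> \<bar>R v\<bar> \<le> BR"
    by (metis bounded_real compact_imp_bounded image_eqI)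
  obtain Bx where Bx: "\<And>k. norm (x k) \<le> Bx"
    using x unfolding bounded_iff by auto
  have D: "bregman \<phi> (x (Suc k)) (x k) \<le> \<eta> k * (G * \<Delta> k + (R (x k) - R (x (Suc k))))" for k
  proof -
    have "- (g k \<bullet> (x (Suc k) - x k)) \<le> G * \<Delta> k"
      using Cauchy_Schwarz_ineq2[of "g k" "x (Suc k) - x k"] mult_right_mono[OF g[of k], of "\<Delta> k"]
      by (simp add: \<Delta>_def)
    hence "1 / \<eta> k * bregman \<phi> (x (Suc k)) (x k) \<le> G * \<Delta> k + (R (x k) - R (x (Suc k)))"
      using descent[of k] by linarith
    thus ?thesis using \<eta>(1)[of k] by (simp add: field_simps)
  qed
  define A where "A = G * (2 * Bx) + 2 * BR + 1"
  have A: "G * \<Delta> k + (R (x k) - R (x (Suc k))) \<le> A" "A > 0" for k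
  proof -
    have "\<Delta> k \<le> 2 * Bx" using norm_triangle_ineq4[of "x (Suc k)" "x k"] Bx[of k] Bx[of "Suc k"] by (simp add: \<Delta>_def)
    hence "G * \<Delta> k \<le> G * (2 * Bx)" using \<open>G \<ge> 0\<close> by (rule mult_left_mono)
    thus "G * \<Delta> k + (R (x k) - R (x (Suc k))) \<le> A"
      using BR[OF xK[of k]] BR[OF xK[of "Suc k"]] by (simp add: A_def)
    have "0 \<le> Bx" "0 \<le> BR" using Bx[of 0] BR[OF xK[of 0]] norm_ge_zero[of "x 0"] by linarith+
    thus "A > 0" using \<open>G \<ge> 0\<close> unfolding A_def by (simp add: add_nonneg_pos)
  qed
  have "\<forall>\<^sub>F k in sequentially. \<eta> k < \<mu> / 8 * r\<^sup>2 / A"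
    using \<eta>(2) \<open>r > 0\<close> \<open>\<mu> > 0\<close> A(2) by (intro order_tendstoD) auto
  hence "\<forall>\<^sub>F k in sequentially. \<Delta> k \<le> 2 * (G + L) / \<mu> * \<eta> k"
  proof eventually_elim
    case (elim k)
    have "\<Delta> k < r"
    proof (rule ccontr)
      assume "\<not> \<Delta> k < r"
      hence "\<mu> / 8 * r\<^sup>2 \<le> bregman \<phi> (x (Suc k)) (x k)"
        using \<open>r > 0\<close> \<open>\<mu> > 0\<close> xK
        by (intro bregman_ge_far[OF \<phi>(1)] r\<phi>(3)) (auto simp: \<Delta>_def r_def dist_norm)
      also have "\<dots> \<le> \<eta> k * A" using D[of k] A(1)[of k] \<eta>(1)[of k]
        by (meson less_imp_le mult_left_mono order_trans)
      finally show False using elim A(2) by (simp add: field_simps)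
    qed
    hence d: "dist (x (Suc k)) (x k) < rR" "dist (x (Suc k)) (x k) < r\<phi>"
      by (auto simp: \<Delta>_def r_def dist_norm)
    have "\<mu> / 2 * (\<Delta> k)\<^sup>2 \<le> \<eta> k * (G * \<Delta> k + (R (x k) - R (x (Suc k))))"
      using r\<phi>(3)[OF xK d(2)] D[of k] by (simp add: \<Delta>_def)
    also have "\<dots> \<le> \<eta> k * (G * \<Delta> k + L * \<Delta> k)"
      using rR(3)[OF xK d(1)] \<eta>(1)[of k]
      by (intro mult_left_mono add_left_mono) (auto simp: dist_real_def \<Delta>_def dist_norm)
    finally have "(\<mu> * \<Delta> k) * \<Delta> k \<le> (2 * (G + L) * \<eta> k) * \<Delta> k"
      by (simp add: power2_eq_square algebra_simps)
    hence "\<mu> * \<Delta> k \<le> 2 * (G + L) * \<eta> k"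
      using \<open>G \<ge> 0\<close> rR(2) \<eta>(1)[of k] by (cases "\<Delta> k = 0") (auto simp: \<Delta>_def)
    thus ?case using \<open>\<mu> > 0\<close> \<eta>(1)[of k] by (simp add: \<Delta>_def field_simps)
  qed
  from eventually_le_imp_le_multiple[OF \<eta>(1) this] obtain C where "C \<ge> 0" "\<And>k. \<Delta> k \<le> C * \<eta> k"
    by blast
  thus ?thesis by (intro that[of C]) (auto simp: \<Delta>_def)
qed

section \<open>Limit curves of discretised inclusions\<close>

text \<open>Tychonoff's theorem: the functions \<open>u j\<close> lie in a compact product, so some filter finer than
  \<open>sequentially\<close> makes them converge at every argument simultaneously. For the limit curves
  pointwise limits are enough, because the inclusion satisfied by the curve is checked at two
  times only.\<close>

lemma pointwise_cluster_filter:
  fixes u :: "nat \<Rightarrow> 'b \<Rightarrow> 'a::metric_space"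
  assumes "compact K" "\<And>j t. u j t \<in> K"
  obtains F z where "F \<noteq> bot" "F \<le> sequentially" "\<And>t. ((\<lambda>j. u j t) \<longlongrightarrow> z t) F"
proof -
  have "compactin (product_topology (\<lambda>_. euclidean) UNIV) (PiE UNIV (\<lambda>_::'b. K))"
    using assms(1) by (simp add: compactin_PiE)
  hence "compact (PiE UNIV (\<lambda>_::'b. K))"
    by (simp add: euclidean_product_topology)
  moreover have "filtermap u sequentially \<noteq> bot"
    by (simp add: filtermap_bot_iff)
  moreover have "\<forall>\<^sub>F w in filtermap u sequentially. w \<in> PiE UNIV (\<lambda>_::'b. K)"
    unfolding eventually_filtermap by (rule always_eventually) (use assms(2) in auto)
  ultimately obtain z where z: "inf (nhds z) (filtermap u sequentially) \<noteq> bot"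
    unfolding compact_filter by blast
  define F where "F = inf sequentially (filtercomap u (nhds z))"
  have "F \<noteq> bot"
  proof
    assume "F = bot"
    hence "eventually (\<lambda>_. False) F" by simp
    then obtain P Q where PQ: "eventually P sequentially" "eventually Q (filtercomap u (nhds z))"
        "\<And>n. P n \<Longrightarrow> Q n \<Longrightarrow> False"
      unfolding F_def eventually_inf by blast
    then obtain R where R: "eventually R (nhds z)" "\<And>n. R (u n) \<Longrightarrow> Q n"
      unfolding eventually_filtercomap by blast
    have "eventually (\<lambda>w. \<not> R w) (filtermap u sequentially)"
      unfolding eventually_filtermap by (rule eventually_mono[OF PQ(1)]) (use PQ(3) R(2) in blast)
    hence "eventually (\<lambda>_. False) (inf (nhds z) (filtermap u sequentially))"
      using R(1) unfolding eventually_inf by blast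
    thus False using z by (simp add: eventually_False)
  qed
  moreover have "F \<le> sequentially" unfolding F_def by simp
  moreover have "((\<lambda>j. u j t) \<longlongrightarrow> z t) F" for t
  proof -
    have "(u \<longlongrightarrow> z) F"
      unfolding F_def by (rule filterlim_mono[OF filterlim_filtercomap order_refl]) simp
    from continuous_on_tendsto_compose[OF continuous_on_product_coordinates this] show ?thesis
      by simp
  qed
  ultimately show ?thesis by (rule that)
qed

lemma has_vector_derivative_imp_diff_quotient:
  assumes "(f has_vector_derivative D) (at t)"
  shows "((\<lambda>h. (f (t + h) - f t) /\<^sub>R h) \<longlongrightarrow> D) (at 0)"
proof -
  have "((\<lambda>h. norm (f (t + h) - f t - h *\<^sub>R D) / norm h) \<longlongrightarrow> 0) (at 0)"
    using assms unfolding has_vector_derivative_def has_derivative_at by simp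
  moreover have "\<forall>\<^sub>F h in at 0. norm (f (t + h) - f t - h *\<^sub>R D) / norm h = norm ((f (t + h) - f t) /\<^sub>R h - D)"
  proof (rule eventually_mono[OF eventually_neq_at_within[of 0]])
    fix h :: real assume "h \<noteq> 0"
    hence "(f (t + h) - f t) /\<^sub>R h - D = (f (t + h) - f t - h *\<^sub>R D) /\<^sub>R h"
      by (simp add: scaleR_diff_right)
    thus "norm (f (t + h) - f t - h *\<^sub>R D) / norm h = norm ((f (t + h) - f t) /\<^sub>R h - D)"
      by (simp add: divide_inverse mult.commute)
  qed
  ultimately have "((\<lambda>h. norm ((f (t + h) - f t) /\<^sub>R h - D)) \<longlongrightarrow> 0) (at 0)"
    by (rule Lim_transform_eventually)
  thus ?thesis using Lim_null tendsto_norm_zero_iff by blast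
qed

text \<open>\<open>S n\<close> is the continuous time at which iterate \<open>n\<close> is reached, and \<open>idx \<tau>\<close> is the first iterate at or
  after time \<open>\<tau>\<close>.\<close>

locale step_sizes =
  fixes \<eta> :: "nat \<Rightarrow> real" and S :: "nat \<Rightarrow> real" and idx :: "real \<Rightarrow> nat"
  defines "S n \<equiv> \<Sum>i<n. \<eta> i" and "idx \<tau> \<equiv> LEAST i. \<tau> \<le> S i"
  assumes \<eta>_pos: "\<And>k. 0 < \<eta> k" and \<eta>_0: "\<eta> \<longlonglongrightarrow> 0"
    and S_at_top: "filterlim S at_top sequentially"
begin

lemma S_Suc: "S (Suc n) = S n + \<eta> n" by (simp add: S_def)

lemma S_strict_mono: "strict_mono S"
  by (rule strict_monoI_Suc) (simp add: S_Suc \<eta>_pos)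

lemma S_less_iff [simp]: "S m < S n \<longleftrightarrow> m < n" by (rule strict_mono_less[OF S_strict_mono])
lemma S_le_iff [simp]: "S m \<le> S n \<longleftrightarrow> m \<le> n" by (rule strict_mono_less_eq[OF S_strict_mono])

lemma S_diff: "m \<le> n \<Longrightarrow> S n - S m = (\<Sum>i=m..<n. \<eta> i)"
  unfolding S_def by (metis sum_diff_nat_ivl lessThan_atLeast0 bot_nat_0.extremum)

lemma idx_ge: "\<tau> \<le> S (idx \<tau>)"
proof -
  have "\<exists>i. \<tau> \<le> S i"
    using S_at_top unfolding filterlim_at_top eventually_sequentially by blast
  thus ?thesis unfolding idx_def by (rule LeastI_ex)
qed

lemma S_less_idx: "i < idx \<tau> \<Longrightarrow> S i < \<tau>"
  unfolding idx_def using not_less_Least[of i "\<lambda>i. \<tau> \<le> S i"] by fastforce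

lemma idx_S [simp]: "idx (S n) = n"
  using idx_ge[of "S n"] S_less_idx[of n "S n"] by (force simp: not_less)

lemma idx_mono: "\<sigma> \<le> \<tau> \<Longrightarrow> idx \<sigma> \<le> idx \<tau>"
  using idx_ge[of \<tau>] S_less_idx[of "idx \<tau>" \<sigma>] by force

lemma idx_ge_start: "0 \<le> s \<Longrightarrow> n \<le> idx (S n + s)"
  using idx_mono[of "S n" "S n + s"] by simp

text \<open>The overshoot of \<open>idx\<close> is at most one step size, taken at an index that tends to infinity.\<close>

lemma S_idx_tendsto:
  assumes "filterlim k at_top sequentially" "0 \<le> s"
  shows "(\<lambda>j. S (idx (S (k j) + s)) - S (k j)) \<longlonglongrightarrow> s"
proof -
  have bound: "S (idx (S n + s)) \<le> S n + s + \<eta> (idx (S n + s) - 1)" for n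
  proof (cases "idx (S n + s)")
    case 0
    have "S 0 \<le> S n" by simp
    thus ?thesis using 0 assms(2) \<eta>_pos[of 0] by (simp add: less_imp_le add_increasing2)
  next
    case (Suc i)
    thus ?thesis using S_less_idx[of i "S n + s"] by (simp add: S_Suc)
  qed
  have "filterlim (\<lambda>j. idx (S (k j) + s) - 1) at_top sequentially"
  proof (rule filterlim_at_top_mono)
    show "filterlim (\<lambda>j. k j - 1) at_top sequentially"
      using filterlim_compose[OF filterlim_minus_const_nat_at_top assms(1), of 1] .
    show "\<forall>\<^sub>F j in sequentially. k j - 1 \<le> idx (S (k j) + s) - 1"
      using idx_ge_start[OF assms(2)] by (intro always_eventually allI diff_le_mono)
  qed
  hence lim: "(\<lambda>j. s + \<eta> (idx (S (k j) + s) - 1)) \<longlonglongrightarrow> s + 0"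
    by (intro tendsto_intros filterlim_compose[OF \<eta>_0])
  show ?thesis
  proof (rule tendsto_sandwich[OF _ _ tendsto_const lim[unfolded add_0_right]])
    show "\<forall>\<^sub>F j in sequentially. s \<le> S (idx (S (k j) + s)) - S (k j)"
      using idx_ge by (intro always_eventually allI) (simp add: le_diff_eq add.commute)
    show "\<forall>\<^sub>F j in sequentially. S (idx (S (k j) + s)) - S (k j) \<le> s + \<eta> (idx (S (k j) + s) - 1)"
      using bound by (intro always_eventually allI) (simp add: algebra_simps)
  qed
qed

end

text \<open>A perturbed discretisation of the inclusion \<open>(\<Phi> \<circ> z)' \<in> - W z\<close>. The set-valued field enters only
  through closed convex values and \<open>W_limit\<close>: limits of the drifts \<open>d k\<close> along iterates tending to \<open>z\<close>
  belong to \<open>W z\<close>. So errors in \<open>d k\<close> that vanish in the limit are already covered. The noise is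
  required to average out only over windows of the countably many time lengths \<open>1 / (p + 1)\<close>.\<close>

locale discrete_inclusion = step_sizes \<eta> S idx
  for \<eta> :: "nat \<Rightarrow> real" and S idx +
  fixes x d \<xi> :: "nat \<Rightarrow> 'a::euclidean_space" and \<Phi> :: "'a \<Rightarrow> 'a"
    and W :: "'a \<Rightarrow> 'a set" and C :: real
  assumes bounded_x: "bounded (range x)"
    and \<Phi>_cont: "continuous_on UNIV \<Phi>"
    and step_x: "\<And>k. norm (x (Suc k) - x k) \<le> C * \<eta> k"
    and step_\<Phi>: "\<And>k. norm (\<Phi> (x (Suc k)) - \<Phi> (x k)) \<le> C * \<eta> k"
    and noise_le: "\<And>k. norm (\<xi> k) \<le> C"
    and update: "\<And>k. \<Phi> (x (Suc k)) = \<Phi> (x k) - \<eta> k *\<^sub>R (d k + \<xi> k)"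
    and noise: "\<And>p. (\<lambda>n. \<Sum>i=n..<idx (S n + 1 / real (Suc p)). \<eta> i *\<^sub>R \<xi> i) \<longlonglongrightarrow> 0"
    and bounded_d: "bounded (range d)"
    and W_closed: "\<And>z. closed (W z)" and W_convex: "\<And>z. convex (W z)"
    and W_limit: "\<And>r z v. filterlim r at_top sequentially \<Longrightarrow> (\<lambda>n. x (r n)) \<longlonglongrightarrow> z \<Longrightarrow>
        (\<lambda>n. d (r n)) \<longlonglongrightarrow> v \<Longrightarrow> v \<in> W z"
begin

lemma telescope_lipschitz:
  fixes u :: "nat \<Rightarrow> 'a"
  assumes "\<And>k. norm (u (Suc k) - u k) \<le> C * \<eta> k"
  shows "norm (u m - u n) \<le> C * \<bar>S m - S n\<bar>"
proof (induction m n rule: linorder_wlog)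
  case (le m n)
  have "norm (u n - u m) = norm (\<Sum>k=m..<n. u (Suc k) - u k)"
    using le by (simp add: sum_Suc_diff')
  also have "\<dots> \<le> (\<Sum>k=m..<n. C * \<eta> k)" by (intro sum_norm_le assms)
  also have "\<dots> = C * (S n - S m)" using le by (simp add: S_diff sum_distrib_left)
  finally show ?case using le by (simp add: norm_minus_commute abs_minus_commute abs_of_nonneg)
qed (simp add: norm_minus_commute abs_minus_commute)

lemmas x_lipschitz = telescope_lipschitz[of x, OF step_x]
lemmas \<Phi>_lipschitz = telescope_lipschitz[of "\<lambda>k. \<Phi> (x k)", OF step_\<Phi>]

lemma noise_sum_lipschitz:
  "norm ((\<Sum>i<m. \<eta> i *\<^sub>R \<xi> i) - (\<Sum>i<n. \<eta> i *\<^sub>R \<xi> i)) \<le> C * \<bar>S m - S n\<bar>"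
proof (rule telescope_lipschitz)
  fix k
  show "norm ((\<Sum>i<Suc k. \<eta> i *\<^sub>R \<xi> i) - (\<Sum>i<k. \<eta> i *\<^sub>R \<xi> i)) \<le> C * \<eta> k"
    using noise_le[of k] \<eta>_pos[of k] by (simp add: mult.commute)
qed

lemma C_nonneg: "0 \<le> C"
  using noise_le[of 0] norm_ge_zero order_trans by blast

lemma closed_convex_enlarged_W:
  "closed (W z + cball 0 \<epsilon>)" "convex (W z + cball 0 \<epsilon>)"
proof -
  have "W z + cball 0 \<epsilon> = (\<Union>u\<in>W z. \<Union>v\<in>cball 0 \<epsilon>. {u + v})"
    by (auto simp: set_plus_def)
  thus "closed (W z + cball 0 \<epsilon>)" using closed_compact_sums[OF W_closed compact_cball] by metis
  show "convex (W z + cball 0 \<epsilon>)" by (intro convex_set_plus W_convex convex_cball)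
qed

text \<open>Upper semicontinuity in the form needed for averaging; it follows from \<open>W_limit\<close> because the drifts
  are bounded.\<close>

lemma d_near_W:
  assumes "\<epsilon> > 0"
  obtains \<rho> N where "\<rho> > 0" "\<And>k. k \<ge> N \<Longrightarrow> dist (x k) z < \<rho> \<Longrightarrow> d k \<in> W z + cball 0 \<epsilon>"
proof -
  have "\<exists>n. \<forall>k\<ge>n. dist (x k) z < inverse (real (Suc n)) \<longrightarrow> d k \<in> W z + cball 0 \<epsilon>"
  proof (rule ccontr)
    assume "\<not> ?thesis"
    hence "\<forall>n. \<exists>k\<ge>n. dist (x k) z < inverse (real (Suc n)) \<and> d k \<notin> W z + cball 0 \<epsilon>"
      by (simp only: not_ex not_all not_imp simp_thms)
    then obtain r where r: "\<And>n. r n \<ge> n" "\<And>n. dist (x (r n)) z < inverse (real (Suc n))"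
        "\<And>n. d (r n) \<notin> W z + cball 0 \<epsilon>"
      by metis
    have "bounded (range (\<lambda>n. d (r n)))" using bounded_d by (rule bounded_subset) auto
    from bounded_imp_convergent_subsequence[OF this] obtain v s where s: "strict_mono s" "((\<lambda>n. d (r n)) \<circ> s) \<longlonglongrightarrow> v"
      by blast
    have "(\<lambda>n. dist (x (r n)) z) \<longlonglongrightarrow> 0"
      by (rule tendsto_sandwich[OF _ _ tendsto_const LIMSEQ_inverse_real_of_nat])
        (simp_all add: less_imp_le[OF r(2)] del: of_nat_Suc)
    hence "(\<lambda>n. x (r n)) \<longlonglongrightarrow> z" by (rule tendsto_dist_iff[THEN iffD2])
    hence "(\<lambda>n. x (r (s n))) \<longlonglongrightarrow> z" by (rule filterlim_compose) (rule filterlim_subseq[OF s(1)])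
    moreover have "filterlim r at_top sequentially"
      by (rule filterlim_at_top_mono[OF filterlim_ident]) (simp add: r(1))
    hence "filterlim (\<lambda>n. r (s n)) at_top sequentially"
      by (rule filterlim_compose) (rule filterlim_subseq[OF s(1)])
    ultimately have v: "v \<in> W z" using W_limit[of "\<lambda>n. r (s n)" z v] s(2) by (simp add: o_def)
    have "\<forall>\<^sub>F n in sequentially. dist (d (r (s n))) v < \<epsilon>"
      using tendstoD[OF s(2) \<open>\<epsilon> > 0\<close>] by (simp add: o_def)
    then obtain n where "dist (d (r (s n))) v < \<epsilon>"
      using eventually_happens'[OF sequentially_bot] by blast
    hence "d (r (s n)) - v \<in> cball 0 \<epsilon>" by (simp add: dist_norm norm_minus_commute)
    with v have "v + (d (r (s n)) - v) \<in> W z + cball 0 \<epsilon>" by (rule set_plus_intro)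
    thus False using r(3) by simp
  qed
  then obtain n where n: "\<forall>k\<ge>n. dist (x k) z < inverse (real (Suc n)) \<longrightarrow> d k \<in> W z + cball 0 \<epsilon>" ..
  show ?thesis by (rule that[of "inverse (real (Suc n))" n]) (use n in simp_all)
qed

text \<open>Over a stretch of iterates, the displacement of \<open>\<Phi>\<close> per unit of time, corrected by the noise, is the
  negative of a convex combination of drifts.\<close>

lemma average_in_convex:
  assumes "convex A" "a < b" "\<And>i. a \<le> i \<Longrightarrow> i < b \<Longrightarrow> d i \<in> A"
  shows "- ((\<Phi> (x b) - \<Phi> (x a) + (\<Sum>i=a..<b. \<eta> i *\<^sub>R \<xi> i)) /\<^sub>R (S b - S a)) \<in> A"
proof -
  have pos: "S b - S a > 0" using assms(2) by simp
  have "\<Phi> (x b) - \<Phi> (x a) = (\<Sum>i=a..<b. \<Phi> (x (Suc i)) - \<Phi> (x i))"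
    using sum_Suc_diff'[of a b "\<lambda>i. \<Phi> (x i)"] assms(2) by simp
  also have "\<dots> = (\<Sum>i=a..<b. - (\<eta> i *\<^sub>R d i) - \<eta> i *\<^sub>R \<xi> i)"
    by (intro sum.cong refl) (simp add: update scaleR_add_right)
  finally have "\<Phi> (x b) - \<Phi> (x a) + (\<Sum>i=a..<b. \<eta> i *\<^sub>R \<xi> i) = - (\<Sum>i=a..<b. \<eta> i *\<^sub>R d i)"
    by (simp add: sum_subtractf sum_negf)
  hence "- ((\<Phi> (x b) - \<Phi> (x a) + (\<Sum>i=a..<b. \<eta> i *\<^sub>R \<xi> i)) /\<^sub>R (S b - S a))
      = (\<Sum>i=a..<b. (\<eta> i / (S b - S a)) *\<^sub>R d i)"
    by (simp add: scaleR_sum_right divide_inverse mult.commute)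
  also have "\<dots> \<in> A"
  proof (rule convex_sum[OF _ assms(1)])
    show "(\<Sum>i=a..<b. \<eta> i / (S b - S a)) = 1"
      using pos assms(2) by (simp add: sum_divide_distrib[symmetric] S_diff)
    show "0 \<le> \<eta> i / (S b - S a)" for i using pos \<eta>_pos[of i] by simp
  qed (use assms(3) in auto)
  finally show ?thesis .
qed

text \<open>Restart the trajectory at the indices \<open>k j\<close>, speed up time by \<open>T\<close>, and pass to a pointwise limit \<open>z\<close>.
  Both \<open>z\<close> and \<open>\<Phi> \<circ> z\<close> inherit the Lipschitz bounds of the iterates. If \<open>\<Phi> \<circ> z\<close> is differentiable at
  \<open>t\<close>, then for small \<open>s\<close> all iterates between the times \<open>t\<close> and \<open>t + s\<close> are near \<open>z t\<close>, so by
  \<open>d_near_W\<close> and \<open>average_in_convex\<close> the difference quotient lies in a small enlargement of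
  \<open>- T W (z t)\<close>, and so does its limit.\<close>

lemma limit_curve:
  assumes k: "filterlim k at_top sequentially" "(\<lambda>j. x (k j)) \<longlonglongrightarrow> xs" and "T > 0"
  obtains F z where "F \<noteq> bot" "F \<le> sequentially" "z 0 = xs"
    "\<And>t. 0 \<le> t \<Longrightarrow> ((\<lambda>j. x (idx (S (k j) + T * t))) \<longlongrightarrow> z t) F"
    "\<And>s t. 0 \<le> s \<Longrightarrow> 0 \<le> t \<Longrightarrow> norm (z t - z s) \<le> C * T * \<bar>t - s\<bar>"
    "\<And>s t. 0 \<le> s \<Longrightarrow> 0 \<le> t \<Longrightarrow> norm (\<Phi> (z t) - \<Phi> (z s)) \<le> C * T * \<bar>t - s\<bar>"
    "\<And>t y'. 0 \<le> t \<Longrightarrow> ((\<lambda>t. \<Phi> (z t)) has_vector_derivative y') (at t) \<Longrightarrow> - (y' /\<^sub>R T) \<in> W (z t)"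
proof -
  define m where "m j t = idx (S (k j) + T * t)" for j t
  have "compact (closure (range x))" using bounded_x by simp
  moreover have "x (m j t) \<in> closure (range x)" for j t
    by (meson closure_subset rangeI subsetD)
  ultimately obtain F z where F: "F \<noteq> bot" "F \<le> sequentially" "\<And>t. ((\<lambda>j. x (m j t)) \<longlongrightarrow> z t) F"
    using pointwise_cluster_filter[of _ "\<lambda>j t. x (m j t)"] by blast
  have Sm: "(\<lambda>j. S (m j t) - S (k j)) \<longlonglongrightarrow> T * t" if "0 \<le> t" for t
    unfolding m_def using k(1) that \<open>T > 0\<close> by (intro S_idx_tendsto) auto
  have Sm_diff: "((\<lambda>j. S (m j t) - S (m j s)) \<longlongrightarrow> T * (t - s)) F" if "0 \<le> s" "0 \<le> t" for s t
  proof -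
    have "(\<lambda>j. (S (m j t) - S (k j)) - (S (m j s) - S (k j))) \<longlonglongrightarrow> T * t - T * s"
      by (intro tendsto_diff Sm that)
    thus ?thesis using F(2) by (auto simp: algebra_simps intro: tendsto_mono)
  qed
  have \<Phi>_lim: "((\<lambda>j. \<Phi> (x (m j t))) \<longlongrightarrow> \<Phi> (z t)) F" for t
    using \<Phi>_cont F(3) by (auto simp: continuous_on_eq_continuous_at intro: isCont_tendsto_compose)
  have z_lip: "norm (z t - z s) \<le> C * T * \<bar>t - s\<bar>" if "0 \<le> s" "0 \<le> t" for s t
  proof (rule tendsto_le[OF F(1)])
    show "((\<lambda>j. norm (x (m j t) - x (m j s))) \<longlongrightarrow> norm (z t - z s)) F"
      by (intro tendsto_intros F)
    have "((\<lambda>j. C * \<bar>S (m j t) - S (m j s)\<bar>) \<longlongrightarrow> C * \<bar>T * (t - s)\<bar>) F"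
      by (intro tendsto_intros Sm_diff that)
    thus "((\<lambda>j. C * \<bar>S (m j t) - S (m j s)\<bar>) \<longlongrightarrow> C * T * \<bar>t - s\<bar>) F"
      using \<open>T > 0\<close> by (simp add: abs_mult mult.assoc)
  qed (simp add: x_lipschitz)
  have \<Phi>_lip: "norm (\<Phi> (z t) - \<Phi> (z s)) \<le> C * T * \<bar>t - s\<bar>" if "0 \<le> s" "0 \<le> t" for s t
  proof (rule tendsto_le[OF F(1)])
    show "((\<lambda>j. norm (\<Phi> (x (m j t)) - \<Phi> (x (m j s)))) \<longlongrightarrow> norm (\<Phi> (z t) - \<Phi> (z s))) F"
      by (intro tendsto_intros \<Phi>_lim)
    have "((\<lambda>j. C * \<bar>S (m j t) - S (m j s)\<bar>) \<longlongrightarrow> C * \<bar>T * (t - s)\<bar>) F"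
      by (intro tendsto_intros Sm_diff that)
    thus "((\<lambda>j. C * \<bar>S (m j t) - S (m j s)\<bar>) \<longlongrightarrow> C * T * \<bar>t - s\<bar>) F"
      using \<open>T > 0\<close> by (simp add: abs_mult mult.assoc)
  qed (simp add: \<Phi>_lipschitz)
  have "((\<lambda>j. x (k j)) \<longlongrightarrow> z 0) F" using F(3)[of 0] by (simp add: m_def)
  hence z0: "z 0 = xs"
    using tendsto_unique[OF F(1)] tendsto_mono[OF F(2) k(2)] by blast
  have m_ge: "k j \<le> m j t" if "0 \<le> t" for j t
    unfolding m_def using that \<open>T > 0\<close> by (intro idx_ge_start) simp
  have deriv: "- (y' /\<^sub>R T) \<in> W (z t)"
    if t: "0 \<le> t" and y': "((\<lambda>t. \<Phi> (z t)) has_vector_derivative y') (at t)" for t y'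
  proof -
    have m_top: "filterlim (\<lambda>j. m j t) at_top sequentially"
      by (rule filterlim_at_top_mono[OF k(1)]) (use m_ge[OF t] in simp)
    \<comment> \<open>These increments correspond to the window lengths for which the noise is controlled.\<close>
    define s where "s p = 1 / (T * real (Suc p))" for p
    have s_pos: "s p > 0" for p using \<open>T > 0\<close> by (simp add: s_def)
    have Ts: "T * s p = 1 / real (Suc p)" for p using \<open>T > 0\<close> by (simp add: s_def)
    have s_0: "s \<longlonglongrightarrow> 0"
    proof -
      have "(\<lambda>p. (1 / T) * inverse (real (Suc p))) \<longlonglongrightarrow> (1 / T) * 0"
        by (intro tendsto_mult tendsto_const LIMSEQ_inverse_real_of_nat)
      moreover have "(\<lambda>p. (1 / T) * inverse (real (Suc p))) = s"
        by (simp add: s_def fun_eq_iff divide_inverse)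
      ultimately show ?thesis by simp
    qed
    have noise_lim: "((\<lambda>j. \<Sum>i=m j t..<m j (t + s p). \<eta> i *\<^sub>R \<xi> i) \<longlongrightarrow> 0) F" for p
    proof -
      \<comment> \<open>The window \<open>[m j t, w j)\<close> of prescribed length and \<open>[m j t, m j (t + s p))\<close> differ by a vanishing time.\<close>
      define w where "w j = idx (S (m j t) + 1 / real (Suc p))" for j
      have w_ge: "m j t \<le> w j" for j unfolding w_def by (rule idx_ge_start) simp
      have ts: "m j t \<le> m j (t + s p)" for j
        unfolding m_def using \<open>T > 0\<close> s_pos[of p] by (intro idx_mono) (simp add: distrib_left)
      have "(\<lambda>j. \<Sum>i=m j t..<w j. \<eta> i *\<^sub>R \<xi> i) \<longlonglongrightarrow> 0"
        unfolding w_def using filterlim_compose[OF noise[of p] m_top] .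
      hence 1: "((\<lambda>j. \<Sum>i=m j t..<w j. \<eta> i *\<^sub>R \<xi> i) \<longlongrightarrow> 0) F" by (rule tendsto_mono[OF F(2)])
      have "((\<lambda>j. C * \<bar>(S (m j (t + s p)) - S (m j t)) - (S (w j) - S (m j t))\<bar>)
          \<longlongrightarrow> C * \<bar>T * (t + s p - t) - 1 / real (Suc p)\<bar>) F"
        unfolding w_def using t s_pos[of p] 
        by (intro tendsto_intros Sm_diff tendsto_mono[OF F(2)] S_idx_tendsto m_top) auto
      hence "((\<lambda>j. C * \<bar>S (m j (t + s p)) - S (w j)\<bar>) \<longlongrightarrow> 0) F"
        using Ts[of p] by simp
      hence "((\<lambda>j. (\<Sum>i<m j (t + s p). \<eta> i *\<^sub>R \<xi> i) - (\<Sum>i<w j. \<eta> i *\<^sub>R \<xi> i)) \<longlongrightarrow> 0) F"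
        by (rule Lim_null_comparison[rotated]) (simp add: noise_sum_lipschitz)
      note tendsto_add[OF 1 this]
      moreover have "(\<Sum>i=m j t..<w j. \<eta> i *\<^sub>R \<xi> i) +
            ((\<Sum>i<m j (t + s p). \<eta> i *\<^sub>R \<xi> i) - (\<Sum>i<w j. \<eta> i *\<^sub>R \<xi> i)) =
            (\<Sum>i=m j t..<m j (t + s p). \<eta> i *\<^sub>R \<xi> i)" for j
      proof -
        have split: "(\<Sum>i=a..<b. \<eta> i *\<^sub>R \<xi> i) = (\<Sum>i<b. \<eta> i *\<^sub>R \<xi> i) - (\<Sum>i<a. \<eta> i *\<^sub>R \<xi> i)"
          if "a \<le> b" for a b :: nat
          using sum_diff_nat_ivl[of 0 a b "\<lambda>i. \<eta> i *\<^sub>R \<xi> i"] that by (simp add: lessThan_atLeast0)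
        show ?thesis unfolding split[OF w_ge] split[OF ts] by simp
      qed
      ultimately show ?thesis by simp
    qed
    have near: "- (y' /\<^sub>R T) \<in> W (z t) + cball 0 \<epsilon>" if "\<epsilon> > 0" for \<epsilon>
    proof -
      obtain \<rho> N where \<rho>: "\<rho> > 0"
        "\<And>i. i \<ge> N \<Longrightarrow> dist (x i) (z t) < \<rho> \<Longrightarrow> d i \<in> W (z t) + cball 0 \<epsilon>"
        using d_near_W[OF \<open>\<epsilon> > 0\<close>] by blast
      define q where "q p = - ((\<Phi> (z (t + s p)) - \<Phi> (z t)) /\<^sub>R (T * s p))" for p
      have "\<forall>\<^sub>F p in sequentially. q p \<in> W (z t) + cball 0 \<epsilon>"
      proof -
        have "(\<lambda>p. C * (T * s p)) \<longlonglongrightarrow> C * (T * 0)" by (intro tendsto_intros s_0)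
        hence "\<forall>\<^sub>F p in sequentially. C * (T * s p) < \<rho> / 2"
          using \<rho>(1) by (intro order_tendstoD) auto
        thus ?thesis
        proof eventually_elim
          case (elim p)
          have sd: "((\<lambda>j. S (m j (t + s p)) - S (m j t)) \<longlongrightarrow> T * s p) F"
            using Sm_diff[of t "t + s p"] t s_pos[of p] by simp
          have Ts_nz: "T * s p \<noteq> 0" using s_pos[of p] \<open>T > 0\<close> by simp
          have "((\<lambda>j. - ((\<Phi> (x (m j (t + s p))) - \<Phi> (x (m j t)) +
              (\<Sum>i=m j t..<m j (t + s p). \<eta> i *\<^sub>R \<xi> i)) /\<^sub>R (S (m j (t + s p)) - S (m j t))))
              \<longlongrightarrow> - ((\<Phi> (z (t + s p)) - \<Phi> (z t) + 0) /\<^sub>R (T * s p))) F"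
            by (intro tendsto_minus tendsto_scaleR tendsto_inverse[OF sd Ts_nz] tendsto_add tendsto_diff \<Phi>_lim noise_lim)
          moreover have "\<forall>\<^sub>F j in F. - ((\<Phi> (x (m j (t + s p))) - \<Phi> (x (m j t)) +
              (\<Sum>i=m j t..<m j (t + s p). \<eta> i *\<^sub>R \<xi> i)) /\<^sub>R (S (m j (t + s p)) - S (m j t)))
              \<in> W (z t) + cball 0 \<epsilon>"
          proof -
            have "((\<lambda>j. C * (S (m j (t + s p)) - S (m j t))) \<longlongrightarrow> C * (T * s p)) F"
              by (intro tendsto_intros sd)
            hence "\<forall>\<^sub>F j in F. C * (S (m j (t + s p)) - S (m j t)) < \<rho> / 2"
              using elim by (rule order_tendstoD)
            moreover have "\<forall>\<^sub>F j in F. dist (x (m j t)) (z t) < \<rho> / 2"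
              using \<rho>(1) F(3) by (intro tendstoD) auto
            moreover have "\<forall>\<^sub>F j in F. S (m j (t + s p)) - S (m j t) > 0"
              using order_tendstoD(1)[OF sd, of 0] s_pos[of p] \<open>T > 0\<close> by simp
            moreover have "\<forall>\<^sub>F j in F. N \<le> m j t"
              using m_top F(2) unfolding filterlim_at_top by (auto simp: le_filter_def)
            ultimately show ?thesis
            proof eventually_elim
              case (elim j)
              show ?case
              proof (rule average_in_convex[OF closed_convex_enlarged_W(2)])
                fix i assume i: "m j t \<le> i" "i < m j (t + s p)"
                have "dist (x i) (x (m j t)) \<le> C * \<bar>S i - S (m j t)\<bar>"
                  unfolding dist_norm by (rule x_lipschitz)
                also have "\<dots> = C * (S i - S (m j t))" using i by (simp add: abs_of_nonneg)
                also have "\<dots> \<le> C * (S (m j (t + s p)) - S (m j t))"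
                  using i C_nonneg by (intro mult_left_mono diff_right_mono) auto
                finally have "dist (x i) (z t) < \<rho>"
                  using elim dist_triangle[of "x i" "z t" "x (m j t)"] by linarith
                thus "d i \<in> W (z t) + cball 0 \<epsilon>" using \<rho>(2) elim i by auto
              qed (use elim in simp)
            qed
          qed
          ultimately show ?case
            using Lim_in_closed_set[OF closed_convex_enlarged_W(1) _ F(1)] unfolding q_def by fastforce
        qed
      qed
      moreover have "q \<longlonglongrightarrow> - (y' /\<^sub>R T)"
      proof -
        have "((\<lambda>h. (\<Phi> (z (t + h)) - \<Phi> (z t)) /\<^sub>R h) \<longlongrightarrow> y') (at 0)"
          using y' by (rule has_vector_derivative_imp_diff_quotient)
        hence "(\<lambda>p. (\<Phi> (z (t + s p)) - \<Phi> (z t)) /\<^sub>R s p) \<longlonglongrightarrow> y'"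
          by (rule filterlim_compose) (use s_0 s_pos in \<open>auto simp: filterlim_at less_imp_neq[symmetric] intro!: always_eventually\<close>)
        hence "(\<lambda>p. - (inverse T *\<^sub>R ((\<Phi> (z (t + s p)) - \<Phi> (z t)) /\<^sub>R s p))) \<longlonglongrightarrow> - (inverse T *\<^sub>R y')"
          by (intro tendsto_intros)
        thus ?thesis unfolding q_def by (simp add: inverse_mult_distrib)
      qed
      ultimately show ?thesis
        by (intro Lim_in_closed_set[OF closed_convex_enlarged_W(1) _ sequentially_bot])
    qed
    have "infdist (- (y' /\<^sub>R T)) (W (z t)) \<le> \<epsilon>" "W (z t) \<noteq> {}" if \<epsilon>: "\<epsilon> > 0" for \<epsilon>
    proof -
      obtain w b where wb: "w \<in> W (z t)" "b \<in> cball 0 \<epsilon>" "- (y' /\<^sub>R T) = w + b"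
        using near[OF \<epsilon>] by (auto elim!: set_plus_elim)
      have "infdist (- (y' /\<^sub>R T)) (W (z t)) \<le> dist (- (y' /\<^sub>R T)) w" by (rule infdist_le[OF wb(1)])
      also have "\<dots> \<le> \<epsilon>" using wb by (simp add: dist_norm)
      finally show "infdist (- (y' /\<^sub>R T)) (W (z t)) \<le> \<epsilon>" .
      show "W (z t) \<noteq> {}" using wb by auto
    qed
    moreover have "infdist (- (y' /\<^sub>R T)) (W (z t)) \<le> 0"
      by (rule field_le_epsilon) (use calculation(1) in simp)
    ultimately show ?thesis
      using in_closed_iff_infdist_zero[OF W_closed] infdist_nonneg by (meson antisym zero_less_one)
  qed
  show ?thesis
    by (rule that[OF F(1,2) z0 F(3)[unfolded m_def] z_lip \<Phi>_lip deriv])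
qed

end

section \<open>Curves and oscillating sequences\<close>

text \<open>Lipschitz curves are the only absolutely continuous ones that occur here.\<close>

lemma abs_continuous_on_lipschitz:
  assumes lip: "\<And>s t. s \<in> I \<Longrightarrow> t \<in> I \<Longrightarrow> dist (\<gamma> s) (\<gamma> t) \<le> L * \<bar>t - s\<bar>"
  shows "abs_continuous_on I \<gamma>"
  unfolding abs_continuous_on_def
proof (intro allI impI)
  fix \<epsilon> :: real assume "\<epsilon> > 0"
  define \<delta> where "\<delta> = \<epsilon> / (\<bar>L\<bar> + 1)"
  have "\<delta> > 0" using \<open>\<epsilon> > 0\<close> by (simp add: \<delta>_def)
  moreover have "(\<Sum>i<n. dist (\<gamma> (a i)) (\<gamma> (b i))) < \<epsilon>"
    if H: "(\<forall>i<n. a i \<le> b i \<and> {a i..b i} \<subseteq> I) \<and> disjoint_family_on (\<lambda>i. {a i<..<b i}) {..<n} \<and>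
      (\<Sum>i<n. b i - a i) < \<delta>" for n and a b :: "nat \<Rightarrow> real"
  proof -
    have "(\<Sum>i<n. dist (\<gamma> (a i)) (\<gamma> (b i))) \<le> (\<Sum>i<n. (\<bar>L\<bar> + 1) * (b i - a i))"
    proof (rule sum_mono)
      fix i assume "i \<in> {..<n}"
      hence "a i \<le> b i" "{a i..b i} \<subseteq> I" using H by auto
      hence i: "a i \<le> b i" "a i \<in> I" "b i \<in> I" by auto
      have "dist (\<gamma> (a i)) (\<gamma> (b i)) \<le> L * (b i - a i)" using lip[OF i(2,3)] i(1) by simp
      also have "\<dots> \<le> (\<bar>L\<bar> + 1) * (b i - a i)" using i(1) by (intro mult_right_mono) auto
      finally show "dist (\<gamma> (a i)) (\<gamma> (b i)) \<le> (\<bar>L\<bar> + 1) * (b i - a i)" .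
    qed
    also have "\<dots> = (\<bar>L\<bar> + 1) * (\<Sum>i<n. b i - a i)" by (simp add: sum_distrib_left)
    also have "\<dots> < (\<bar>L\<bar> + 1) * \<delta>" using H by (intro mult_strict_left_mono) auto
    also have "\<dots> = \<epsilon>" by (simp add: \<delta>_def)
    finally show ?thesis .
  qed
  ultimately show "\<exists>\<delta>>0. \<forall>(n::nat) a b. (\<forall>i<n. a i \<le> b i \<and> {a i..b i} \<subseteq> I) \<and>
      disjoint_family_on (\<lambda>i. {a i<..<b i}) {..<n} \<and> (\<Sum>i<n. b i - a i) < \<delta> \<longrightarrow>
      (\<Sum>i<n. dist (\<gamma> (a i)) (\<gamma> (b i))) < \<epsilon>"
    by blast
qed

lemma AE_unit_interval_witness:
  assumes "AE t in lborel. t \<in> {0<..<1::real} \<longrightarrow> P t"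
  obtains t where "t \<in> {0<..<1}" "P t"
proof -
  have "\<exists>t\<in>{0<..<1::real}. P t"
  proof (rule ccontr)
    assume *: "\<not> ?thesis"
    have "AE t in lborel. t \<notin> {0<..<1::real}"
      using assms by eventually_elim (use * in auto)
    hence "emeasure lborel {0<..<1::real} = 0"
      by (subst (asm) AE_iff_measurable[of "{0<..<1}"]) auto
    thus False by simp
  qed
  thus ?thesis using that by blast
qed

text \<open>Apply \<open>nonincreasing_if_AE_deriv_nonpos\<close> to each coordinate and to its negative.\<close>

lemma constant_if_AE_deriv_zero:
  fixes z :: "real \<Rightarrow> 'a::euclidean_space"
  assumes lip: "\<And>s t. s \<in> {0..1} \<Longrightarrow> t \<in> {0..1} \<Longrightarrow> norm (z t - z s) \<le> L * \<bar>t - s\<bar>"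
    and deriv: "AE t in lborel. t \<in> {0<..<1} \<longrightarrow> (z has_vector_derivative 0) (at t)"
    and "t \<in> {0..1}"
  shows "z t = z 0"
proof (rule euclidean_eqI)
  fix b :: 'a assume b: "b \<in> Basis"
  have le: "c * (z t \<bullet> b) \<le> c * (z 0 \<bullet> b)" if c: "\<bar>c\<bar> = 1" for c :: real
  proof (rule nonincreasing_if_AE_deriv_nonpos[of 0 t 1 "\<lambda>t. c * (z t \<bullet> b)" L])
    show "\<bar>c * (z u \<bullet> b) - c * (z v \<bullet> b)\<bar> \<le> L * \<bar>u - v\<bar>" if "u \<in> {0..t}" "v \<in> {0..t}" for u v
    proof -
      have "\<bar>c * (z u \<bullet> b) - c * (z v \<bullet> b)\<bar> = \<bar>(z u - z v) \<bullet> b\<bar>"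
        using c by (simp add: right_diff_distrib[symmetric] abs_mult inner_diff_left)
      also have "\<dots> \<le> norm (z u - z v)" by (rule Basis_le_norm[OF b])
      also have "\<dots> \<le> L * \<bar>u - v\<bar>" using that \<open>t \<in> {0..1}\<close> by (intro lip) auto
      finally show ?thesis .
    qed
    show "AE u in lborel. u \<in> {0<..<t} \<longrightarrow> (\<exists>D\<le>0. ((\<lambda>t. c * (z t \<bullet> b)) has_real_derivative D) (at u))"
      using deriv
    proof eventually_elim
      case (elim u)
      show ?case
      proof (intro impI exI[of _ 0] conjI)
        assume "u \<in> {0<..<t}"
        hence "(z has_vector_derivative 0) (at u)" using elim \<open>t \<in> {0..1}\<close> by auto
        hence "(z has_derivative (\<lambda>_. 0)) (at u)" by (simp add: has_vector_derivative_def)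
        from has_derivative_mult_right[OF has_derivative_inner_left[OF this], of c b]
        show "((\<lambda>t. c * (z t \<bullet> b)) has_real_derivative 0) (at u)"
          by (simp add: has_field_derivative_def lambda_zero)
      qed simp
    qed
  qed (use \<open>t \<in> {0..1}\<close> in auto)
  show "z t \<bullet> b = z 0 \<bullet> b" using le[of 1] le[of "-1"] by simp
qed

lemma oscillation_if_not_convergent:
  fixes u :: "nat \<Rightarrow> real"
  assumes "bounded (range u)" "\<not> convergent u"
  obtains a b where "a < b" "\<exists>\<^sub>F n in sequentially. u n < a" "\<exists>\<^sub>F n in sequentially. b < u n"
proof -
  obtain l s where s: "strict_mono s" "(u \<circ> s) \<longlonglongrightarrow> l"
    using bounded_imp_convergent_subsequence[OF assms(1)] by blast
  have "\<not> u \<longlonglongrightarrow> l" using assms(2) by (auto simp: convergent_def)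
  then obtain e where e: "e > 0" "\<exists>\<^sub>F n in sequentially. \<not> dist (u n) l < e"
    unfolding tendsto_iff by (auto simp: not_eventually)
  have near: "\<exists>\<^sub>F n in sequentially. dist (u n) l < e / 3"
    unfolding frequently_sequentially
  proof
    fix N
    have "\<forall>\<^sub>F n in sequentially. dist (u (s n)) l < e / 3 \<and> n \<ge> N"
      using tendstoD[OF s(2), of "e / 3"] e(1) by (intro eventually_conj eventually_ge_at_top) (simp add: o_def)
    then obtain n where n: "dist (u (s n)) l < e / 3" "n \<ge> N"
      using eventually_happens'[OF sequentially_bot] by blast
    thus "\<exists>m\<ge>N. dist (u m) l < e / 3"
      using seq_suble[OF s(1), of n] by (intro exI[of _ "s n"]) auto
  qed
  have "\<exists>\<^sub>F n in sequentially. l + e / 2 < u n \<or> u n < l - e / 2"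
    using e(2) by (rule frequently_elim1) (use e(1) in \<open>auto simp: dist_real_def\<close>)
  hence "(\<exists>\<^sub>F n in sequentially. l + e / 2 < u n) \<or> (\<exists>\<^sub>F n in sequentially. u n < l - e / 2)"
    by (simp add: frequently_disj_iff)
  thus ?thesis
  proof
    assume "\<exists>\<^sub>F n in sequentially. l + e / 2 < u n"
    moreover have "\<exists>\<^sub>F n in sequentially. u n < l + e / 3"
      using near by (rule frequently_elim1) (unfold dist_real_def, linarith)
    ultimately show ?thesis using e(1) by (intro that[of "l + e / 3" "l + e / 2"]) auto
  next
    assume "\<exists>\<^sub>F n in sequentially. u n < l - e / 2"
    moreover have "\<exists>\<^sub>F n in sequentially. l - e / 3 < u n"
      using near by (rule frequently_elim1) (unfold dist_real_def, linarith)
    ultimately show ?thesis using e(1) by (intro that[of "l - e / 2" "l - e / 3"]) auto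
  qed
qed

text \<open>Between a visit below \<open>a\<close> and a later visit above \<open>b\<close>, take the last index at which \<open>u \<le> c\<close>.\<close>

lemma last_upcrossing:
  fixes u :: "nat \<Rightarrow> real"
  assumes "\<exists>\<^sub>F n in sequentially. u n < a" "\<exists>\<^sub>F n in sequentially. b < u n" "a \<le> c" "c \<le> b"
  obtains k m where "N \<le> k" "k < m" "u k \<le> c" "b < u m" "\<And>i. k < i \<Longrightarrow> i \<le> m \<Longrightarrow> c < u i"
proof -
  obtain n where n: "n \<ge> N" "u n < a" using assms(1) unfolding frequently_sequentially by blast
  obtain m where m: "m \<ge> n" "b < u m" using assms(2) unfolding frequently_sequentially by blast
  define k where "k = Max {i. i \<le> m \<and> u i \<le> c}"
  have fin: "finite {i. i \<le> m \<and> u i \<le> c}" by simp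
  have nin: "n \<in> {i. i \<le> m \<and> u i \<le> c}" using n m assms by auto
  have "k \<in> {i. i \<le> m \<and> u i \<le> c}" unfolding k_def using fin nin by (intro Max_in) auto
  moreover have "n \<le> k" unfolding k_def using fin nin by (intro Max_ge)
  moreover have "c < u i" if "k < i" "i \<le> m" for i
  proof (rule ccontr)
    assume "\<not> c < u i"
    hence "i \<in> {i. i \<le> m \<and> u i \<le> c}" using that by simp
    from Max_ge[OF fin this] show False using that by (simp add: k_def)
  qed
  ultimately show ?thesis
    using n m assms by (intro that[of k m]) (auto simp: le_less)
qed

section \<open>The objective as a Lyapunov function\<close>

text \<open>The mirror map is \<open>\<Phi> = gradient \<phi>\<close> and \<open>h = f + R\<close> is the Lyapunov function. The field \<open>W\<close> may be smaller
  than \<open>Df + DR + normal_cone X\<close>, because that sum need not have the closure property \<open>W_limit\<close>.\<close>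

locale bregman_inclusion =
  discrete_inclusion \<eta> S idx x d \<xi> "gradient \<phi>" W C
  for \<eta> S idx and x d \<xi> :: "nat \<Rightarrow> 'a::euclidean_space" and W C and \<phi> :: "'a \<Rightarrow> real" +
  fixes f R :: "'a \<Rightarrow> real" and Df DR :: "'a \<Rightarrow> 'a set" and X :: "'a set" and h :: "'a \<Rightarrow> real"
  defines "h y \<equiv> f y + R y"
  assumes \<phi>_strong: "locally_strongly_convex \<phi>" and \<phi>_diff: "\<And>y. \<phi> differentiable (at y)"
    and X_closed: "closed X" and x_in_X: "\<And>k. x k \<in> X"
    and Df: "conservative_field Df f" and DR: "conservative_field DR R"
    and chain: "admits_chain_rule X"
    and W_subset: "\<And>z. W z \<subseteq> Df z + DR z + normal_cone X z"
begin

lemma h_lipschitz: "locally_lipschitz h"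
  unfolding locally_lipschitz_def
proof
  fix u
  obtain r1 L1 where 1: "r1 > 0" "L1-lipschitz_on (ball u r1) f"
    using Df unfolding conservative_field_def locally_lipschitz_def by blast
  obtain r2 L2 where 2: "r2 > 0" "L2-lipschitz_on (ball u r2) R"
    using DR unfolding conservative_field_def locally_lipschitz_def by blast
  have "(L1 + L2)-lipschitz_on (ball u (min r1 r2)) h"
    unfolding h_def by (intro lipschitz_on_add lipschitz_on_subset[OF 1(2)] lipschitz_on_subset[OF 2(2)]) auto
  thus "\<exists>r>0. \<exists>L. L-lipschitz_on (ball u r) h"
    using 1(1) 2(1) by (intro exI[of _ "min r1 r2"]) auto
qed

lemma h_cont: "continuous_on UNIV h"
  by (rule locally_lipschitz_imp_continuous_on[OF h_lipschitz])

lemma h_tendsto: "(u \<longlongrightarrow> l) F \<Longrightarrow> ((\<lambda>j. h (u j)) \<longlongrightarrow> h l) F"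
  using continuous_on_tendsto_compose[OF h_cont] by fastforce

lemma compact_closure_range: "compact (closure (range x))"
  using bounded_x by simp

lemma x_in_closure: "x k \<in> closure (range x)"
  by (meson closure_subset rangeI subsetD)

lemma gradient_strongly_monotone_near:
  assumes "compact K"
  obtains r \<mu> where "r > 0" "\<mu> > 0"
    "\<And>u v. u \<in> K \<Longrightarrow> v \<in> K \<Longrightarrow> dist u v < r \<Longrightarrow>
      \<mu> * (norm (u - v))\<^sup>2 \<le> (gradient \<phi> u - gradient \<phi> v) \<bullet> (u - v)"
proof -
  obtain r \<mu> where r: "r > 0" "\<mu> > 0"
    "\<And>x y. y \<in> K \<Longrightarrow> dist x y < r \<Longrightarrow> \<mu> / 2 * (norm (x - y))\<^sup>2 \<le> bregman \<phi> x y"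
    using bregman_ge_near_compact[OF \<phi>_strong \<phi>_diff assms] by blast
  have "\<mu> * (norm (u - v))\<^sup>2 \<le> (gradient \<phi> u - gradient \<phi> v) \<bullet> (u - v)"
    if "u \<in> K" "v \<in> K" "dist u v < r" for u v
  proof -
    have "bregman \<phi> u v + bregman \<phi> v u = (gradient \<phi> u - gradient \<phi> v) \<bullet> (u - v)"
      by (simp add: bregman_def inner_diff_left inner_diff_right)
    moreover have "\<mu> / 2 * (norm (u - v))\<^sup>2 \<le> bregman \<phi> u v" using that by (intro r) auto
    moreover have "\<mu> / 2 * (norm (v - u))\<^sup>2 \<le> bregman \<phi> v u" using that by (intro r) (auto simp: dist_commute)
    ultimately show ?thesis by (simp add: norm_minus_commute[of v u])
  qed
  thus ?thesis using r(1,2) that by blast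
qed

text \<open>At almost every \<open>t\<close> write \<open>- y' / T = vf + vR + vX\<close> with \<open>y = gradient \<phi> \<circ> z\<close>. The chain rules for \<open>Df\<close>
  and \<open>DR\<close> give \<open>(h \<circ> z)' = (vf + vR) \<bullet> z'\<close>, the chain rule on \<open>X\<close> allows adding \<open>vX\<close>, and so
  \<open>(h \<circ> z)' = - (y' \<bullet> z') / T\<close>. Strong monotonicity of the gradient, applied to difference quotients,
  gives \<open>y' \<bullet> z' \<ge> \<mu> (norm z')\<^sup>2\<close>. That \<open>z\<close> and \<open>y\<close> are differentiable almost everywhere is part of the
  definition of a conservative field, which is why \<open>Df\<close> is also applied to the curve \<open>y\<close>.\<close>

lemma AE_derivatives_along_curve:
  assumes "T > 0"
    and z_lip: "\<And>s t. 0 \<le> s \<Longrightarrow> 0 \<le> t \<Longrightarrow> norm (z t - z s) \<le> L * \<bar>t - s\<bar>"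
    and y_lip: "\<And>s t. 0 \<le> s \<Longrightarrow> 0 \<le> t \<Longrightarrow> norm (gradient \<phi> (z t) - gradient \<phi> (z s)) \<le> L * \<bar>t - s\<bar>"
    and z_K: "\<And>t. 0 \<le> t \<Longrightarrow> z t \<in> K" "compact K"
    and z_X: "\<And>t. 0 \<le> t \<Longrightarrow> z t \<in> X"
    and incl: "\<And>t y'. 0 \<le> t \<Longrightarrow> ((\<lambda>t. gradient \<phi> (z t)) has_vector_derivative y') (at t) \<Longrightarrow> - (y' /\<^sub>R T) \<in> W (z t)"
  obtains \<mu> where "\<mu> > 0" "AE t in lborel. t \<in> {0<..<1} \<longrightarrow> (\<exists>z' y' D.
      (z has_vector_derivative z') (at t) \<and>
      ((\<lambda>t. gradient \<phi> (z t)) has_vector_derivative y') (at t) \<and>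
      ((\<lambda>t. h (z t)) has_real_derivative D) (at t) \<and> D \<le> - (\<mu> * (norm z')\<^sup>2))"
proof -
  define y where "y t = gradient \<phi> (z t)" for t
  obtain r \<mu> where r: "r > 0" "\<mu> > 0" "\<And>u v. u \<in> K \<Longrightarrow> v \<in> K \<Longrightarrow> dist u v < r \<Longrightarrow>
      \<mu> * (norm (u - v))\<^sup>2 \<le> (gradient \<phi> u - gradient \<phi> v) \<bullet> (u - v)"
    using gradient_strongly_monotone_near[OF z_K(2)] by blast
  have z_ac: "abs_continuous_on {0..1} z"
    by (rule abs_continuous_on_lipschitz[of _ _ L]) (use z_lip in \<open>auto simp: dist_norm norm_minus_commute\<close>)
  have y_ac: "abs_continuous_on {0..1} y"
    by (rule abs_continuous_on_lipschitz[of _ _ L]) (use y_lip in \<open>auto simp: y_def dist_norm norm_minus_commute\<close>)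
  have 1: "AE t in lborel. t \<in> {0..1} \<longrightarrow> (\<exists>\<gamma>'. (z has_vector_derivative \<gamma>') (at t) \<and>
          (\<forall>v\<in>Df (z t). ((\<lambda>s. f (z s)) has_real_derivative (v \<bullet> \<gamma>')) (at t)))"
    using Df z_ac unfolding conservative_field_def by blast
  have 2: "AE t in lborel. t \<in> {0..1} \<longrightarrow> (\<exists>\<gamma>'. (z has_vector_derivative \<gamma>') (at t) \<and>
          (\<forall>v\<in>DR (z t). ((\<lambda>s. R (z s)) has_real_derivative (v \<bullet> \<gamma>')) (at t)))"
    using DR z_ac unfolding conservative_field_def by blast
  have 3: "AE t in lborel. t \<in> {0..1} \<longrightarrow> (\<exists>\<gamma>'. (z has_vector_derivative \<gamma>') (at t) \<and>
          (\<forall>v\<in>normal_cone X (z t). v \<bullet> \<gamma>' = 0))"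
    using chain z_ac z_X unfolding admits_chain_rule_def by (auto simp: image_subset_iff)
  have 4: "AE t in lborel. t \<in> {0..1} \<longrightarrow> (\<exists>\<gamma>'. (y has_vector_derivative \<gamma>') (at t) \<and>
          (\<forall>v\<in>Df (y t). ((\<lambda>s. f (y s)) has_real_derivative (v \<bullet> \<gamma>')) (at t)))"
    using Df y_ac unfolding conservative_field_def by blast
  have "AE t in lborel. t \<in> {0<..<1} \<longrightarrow> (\<exists>z' y' D.
      (z has_vector_derivative z') (at t) \<and> (y has_vector_derivative y') (at t) \<and>
      ((\<lambda>t. h (z t)) has_real_derivative D) (at t) \<and> D \<le> - (\<mu> / T * (norm z')\<^sup>2))"
    using 1 2 3 4
  proof eventually_elim
    case (elim t)
    show ?case
    proof
      assume t: "t \<in> {0<..<1}"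
      then obtain z' where z': "(z has_vector_derivative z') (at t)"
          "\<And>v. v \<in> Df (z t) \<Longrightarrow> ((\<lambda>s. f (z s)) has_real_derivative (v \<bullet> z')) (at t)"
        using elim(1) by auto
      have R': "((\<lambda>s. R (z s)) has_real_derivative (v \<bullet> z')) (at t)" if "v \<in> DR (z t)" for v
        using elim(2) t that vector_derivative_unique_at[OF z'(1)] by fastforce
      have X': "v \<bullet> z' = 0" if "v \<in> normal_cone X (z t)" for v
        using elim(3) t that vector_derivative_unique_at[OF z'(1)] by fastforce
      obtain y' where y': "(y has_vector_derivative y') (at t)" using elim(4) t by auto
      have "- (y' /\<^sub>R T) \<in> W (z t)" using incl[of t y'] y' t by (simp add: y_def[abs_def])
      then obtain vf vR vX where v: "vf \<in> Df (z t)" "vR \<in> DR (z t)" "vX \<in> normal_cone X (z t)"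
          "- (y' /\<^sub>R T) = vf + vR + vX"
        using W_subset by (blast elim!: set_plus_elim)
      have "((\<lambda>s. h (z s)) has_real_derivative (vf \<bullet> z' + vR \<bullet> z')) (at t)"
        unfolding h_def by (intro DERIV_add z' R' v)
      moreover have "vf \<bullet> z' + vR \<bullet> z' = - (y' \<bullet> z') / T"
      proof -
        have "vf \<bullet> z' + vR \<bullet> z' = (vf + vR + vX) \<bullet> z'" using X'[OF v(3)] by (simp add: inner_add_left)
        also have "\<dots> = - (y' \<bullet> z') / T" unfolding v(4)[symmetric] by (simp add: divide_inverse)
        finally show ?thesis .
      qed
      moreover have "\<mu> * (norm z')\<^sup>2 \<le> y' \<bullet> z'"
      proof (rule tendsto_le[of "at (0::real)"])
        show "((\<lambda>s. ((y (t + s) - y t) /\<^sub>R s) \<bullet> ((z (t + s) - z t) /\<^sub>R s)) \<longlongrightarrow> y' \<bullet> z') (at 0)"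
          by (intro tendsto_inner has_vector_derivative_imp_diff_quotient y' z')
        show "((\<lambda>s. \<mu> * (norm ((z (t + s) - z t) /\<^sub>R s))\<^sup>2) \<longlongrightarrow> \<mu> * (norm z')\<^sup>2) (at 0)"
          by (intro tendsto_intros has_vector_derivative_imp_diff_quotient z')
        have "\<forall>\<^sub>F s in at 0. dist s 0 < min t (r / (\<bar>L\<bar> + 1)) \<and> s \<noteq> 0"
          unfolding eventually_at using t r(1) by (intro exI[of _ "min t (r / (\<bar>L\<bar> + 1))"]) auto
        thus "\<forall>\<^sub>F s in at 0. \<mu> * (norm ((z (t + s) - z t) /\<^sub>R s))\<^sup>2
            \<le> ((y (t + s) - y t) /\<^sub>R s) \<bullet> ((z (t + s) - z t) /\<^sub>R s)"
        proof eventually_elim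
          case (elim s)
          hence s: "0 \<le> t + s" "0 \<le> t" "s \<noteq> 0" "\<bar>s\<bar> < r / (\<bar>L\<bar> + 1)" using t by auto
          have "dist (z (t + s)) (z t) \<le> L * \<bar>s\<bar>" using z_lip[OF s(2,1)] by (simp add: dist_norm)
          also have "\<dots> \<le> (\<bar>L\<bar> + 1) * \<bar>s\<bar>" by (intro mult_right_mono) auto
          also have "\<dots> < r" using s(4) by (simp add: field_simps)
          finally have "\<mu> * (norm (z (t + s) - z t))\<^sup>2 \<le> (y (t + s) - y t) \<bullet> (z (t + s) - z t)"
            unfolding y_def by (intro r z_K s)
          hence "\<mu> * (norm (z (t + s) - z t))\<^sup>2 / (s * s) \<le> ((y (t + s) - y t) \<bullet> (z (t + s) - z t)) / (s * s)"
            by (rule divide_right_mono) simp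
          moreover have nsq: "(norm (v /\<^sub>R s))\<^sup>2 = (norm v)\<^sup>2 / (s * s)" for v :: 'a
            by (simp add: power_mult_distrib power_inverse divide_inverse power2_eq_square[of s] del: abs_inverse)
          ultimately show ?case unfolding nsq by (simp add: divide_inverse mult_ac)
        qed
      qed simp
      hence "- (y' \<bullet> z') / T \<le> - (\<mu> / T * (norm z')\<^sup>2)" using \<open>T > 0\<close> by (simp add: field_simps)
      ultimately show "\<exists>z' y' D. (z has_vector_derivative z') (at t) \<and> (y has_vector_derivative y') (at t) \<and>
          ((\<lambda>t. h (z t)) has_real_derivative D) (at t) \<and> D \<le> - (\<mu> / T * (norm z')\<^sup>2)"
        using z'(1) y' by (intro exI[of _ z'] exI[of _ y'] exI[of _ "- (y' \<bullet> z') / T"]) auto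
    qed
  qed
  from that[OF _ this[unfolded y_def[abs_def]]] show ?thesis using \<open>T > 0\<close> r(2) by simp
qed

text \<open>If \<open>h\<close> does not fall below \<open>h xs\<close> during a fixed time after the visits to \<open>xs\<close>, then along the limit curve
  \<open>h\<close> is bounded below by its initial value and nonincreasing, hence constant. Then the speed of the
  curve vanishes almost everywhere, the curve stays at \<open>xs\<close>, and the inclusion at any time reads \<open>0 \<in> W xs\<close>.\<close>

lemma stationary_if_no_descent:
  assumes k: "filterlim k at_top sequentially" "(\<lambda>j. x (k j)) \<longlonglongrightarrow> xs" and "T > 0"
    and low: "\<And>\<epsilon>. \<epsilon> > 0 \<Longrightarrow> \<forall>\<^sub>F j in sequentially. \<forall>i\<ge>k j. S i - S (k j) \<le> T \<longrightarrow> h xs - \<epsilon> \<le> h (x i)"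
  shows "0 \<in> W xs"
proof -
  \<comment> \<open>Half the window: for each time in \<open>[0, 1]\<close> the discretised time is then eventually strictly inside the window.\<close>
  define T' where "T' = T / 2"
  have "T' > 0" "T' < T" using \<open>T > 0\<close> by (auto simp: T'_def)
  obtain F z where F: "F \<noteq> bot" "F \<le> sequentially" and z0: "z 0 = xs"
    and lim: "\<And>t. 0 \<le> t \<Longrightarrow> ((\<lambda>j. x (idx (S (k j) + T' * t))) \<longlongrightarrow> z t) F"
    and z_lip: "\<And>s t. 0 \<le> s \<Longrightarrow> 0 \<le> t \<Longrightarrow> norm (z t - z s) \<le> C * T' * \<bar>t - s\<bar>"
    and y_lip: "\<And>s t. 0 \<le> s \<Longrightarrow> 0 \<le> t \<Longrightarrow> norm (gradient \<phi> (z t) - gradient \<phi> (z s)) \<le> C * T' * \<bar>t - s\<bar>"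
    and incl: "\<And>t y'. 0 \<le> t \<Longrightarrow> ((\<lambda>t. gradient \<phi> (z t)) has_vector_derivative y') (at t) \<Longrightarrow> - (y' /\<^sub>R T') \<in> W (z t)"
    using limit_curve[OF k \<open>T' > 0\<close>] by blast
  define K where "K = closure (range x)"
  have K: "compact K" unfolding K_def by (rule compact_closure_range)
  have z_K: "z t \<in> K" if "0 \<le> t" for t
    by (rule Lim_in_closed_set[OF _ _ F(1) lim[OF that]]) (auto simp: K_def x_in_closure)
  have z_X: "z t \<in> X" if "0 \<le> t" for t
    by (rule Lim_in_closed_set[OF X_closed _ F(1) lim[OF that]]) (simp add: x_in_X)
  have g_ge: "h xs \<le> h (z t)" if t: "0 \<le> t" "t \<le> 1" for t
  proof (rule field_le_epsilon)
    fix \<epsilon> :: real assume "\<epsilon> > 0"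
    have "(\<lambda>j. S (idx (S (k j) + T' * t)) - S (k j)) \<longlonglongrightarrow> T' * t"
      using t \<open>T' > 0\<close> by (intro S_idx_tendsto k) auto
    moreover have "T' * t \<le> T' * 1" using t \<open>T' > 0\<close> by (intro mult_left_mono) auto
    hence "T' * t < T" using \<open>T' < T\<close> by linarith
    ultimately have "\<forall>\<^sub>F j in sequentially. S (idx (S (k j) + T' * t)) - S (k j) < T"
      by (rule order_tendstoD)
    with low[OF \<open>\<epsilon> > 0\<close>] have "\<forall>\<^sub>F j in sequentially. h xs - \<epsilon> \<le> h (x (idx (S (k j) + T' * t)))"
    proof eventually_elim
      case (elim j)
      have "k j \<le> idx (S (k j) + T' * t)" using t \<open>T' > 0\<close> by (intro idx_ge_start) simp
      thus ?case using elim by auto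
    qed
    hence "\<forall>\<^sub>F j in F. h xs - \<epsilon> \<le> h (x (idx (S (k j) + T' * t)))" using F(2) by (auto simp: le_filter_def)
    from tendsto_lowerbound[OF h_tendsto[OF lim[OF t(1)]] this F(1)]
    show "h xs \<le> h (z t) + \<epsilon>" by simp
  qed
  obtain \<mu> where \<mu>: "\<mu> > 0" and ae: "AE t in lborel. t \<in> {0<..<1} \<longrightarrow> (\<exists>z' y' D.
      (z has_vector_derivative z') (at t) \<and>
      ((\<lambda>t. gradient \<phi> (z t)) has_vector_derivative y') (at t) \<and>
      ((\<lambda>t. h (z t)) has_real_derivative D) (at t) \<and> D \<le> - (\<mu> * (norm z')\<^sup>2))"
    using AE_derivatives_along_curve[OF \<open>T' > 0\<close> z_lip y_lip z_K K z_X incl] by blast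
  obtain r L where r: "r > 0" "L \<ge> 0" "\<And>u v. v \<in> K \<Longrightarrow> dist u v < r \<Longrightarrow> dist (h u) (h v) \<le> L * dist u v"
    using locally_lipschitz_near_compact[OF h_lipschitz K] by blast
  have g_const: "h (z t) = h xs" if t: "t \<in> {0..1}" for t
  proof (rule antisym)
    define r' where "r' = r / (\<bar>C * T'\<bar> + 1)"
    have "h (z t) \<le> h (z 0)"
    proof (rule nonincreasing_if_AE_deriv_nonpos[of 0 t r' "\<lambda>t. h (z t)" "L * (C * T')"])
      show "\<bar>h (z s) - h (z u)\<bar> \<le> L * (C * T') * \<bar>s - u\<bar>"
        if su: "s \<in> {0..t}" "u \<in> {0..t}" "\<bar>s - u\<bar> < r'" for s u
      proof -
        have d: "dist (z s) (z u) \<le> C * T' * \<bar>s - u\<bar>" using su by (auto simp: dist_norm intro: z_lip)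
        also have "\<dots> \<le> (\<bar>C * T'\<bar> + 1) * \<bar>s - u\<bar>" by (intro mult_right_mono) auto
        also have "\<dots> < r" using su(3) by (simp add: r'_def field_simps)
        finally have "\<bar>h (z s) - h (z u)\<bar> \<le> L * dist (z s) (z u)"
          using su by (intro r(3)[unfolded dist_real_def] z_K) auto
        also have "\<dots> \<le> L * (C * T' * \<bar>s - u\<bar>)" using d r(2) by (rule mult_left_mono)
        finally show ?thesis by (simp add: mult.assoc)
      qed
      show "AE s in lborel. s \<in> {0<..<t} \<longrightarrow> (\<exists>D\<le>0. ((\<lambda>t. h (z t)) has_real_derivative D) (at s))"
        using ae
      proof eventually_elim
        case (elim s)
        show ?case
        proof
          assume "s \<in> {0<..<t}"
          hence "s \<in> {0<..<1}" using t by auto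
          then obtain z' :: 'a and D where D: "((\<lambda>t. h (z t)) has_real_derivative D) (at s)" "D \<le> - (\<mu> * (norm z')\<^sup>2)"
            using elim by auto
          moreover have "0 \<le> \<mu> * (norm z')\<^sup>2" using \<mu> by simp
          ultimately show "\<exists>D\<le>0. ((\<lambda>t. h (z t)) has_real_derivative D) (at s)"
            by (intro exI[of _ D]) auto
        qed
      qed
      show "r' > 0" using r(1) by (simp add: r'_def add_nonneg_pos)
    qed (use t in auto)
    thus "h (z t) \<le> h xs" by (simp add: z0)
  qed (use g_ge t in auto)
  have "AE t in lborel. t \<in> {0<..<1} \<longrightarrow> (z has_vector_derivative 0) (at t)"
    using ae
  proof eventually_elim
    case (elim t)
    show ?case
    proof
      assume t: "t \<in> {0<..<1}"
      then obtain z' D where D: "(z has_vector_derivative z') (at t)"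
          "((\<lambda>t. h (z t)) has_real_derivative D) (at t)" "D \<le> - (\<mu> * (norm z')\<^sup>2)"
        using elim by auto
      have "D = 0"
        by (rule DERIV_local_const[OF D(2), of "min t (1 - t)"]) (use t in \<open>auto simp: g_const abs_if split: if_splits\<close>)
      hence "z' = 0" using D(3) \<mu> by (simp add: mult_le_0_iff)
      thus "(z has_vector_derivative 0) (at t)" using D(1) by simp
    qed
  qed
  hence z_const: "z t = xs" if "t \<in> {0..1}" for t
    using constant_if_AE_deriv_zero[of z "C * T'" t] z_lip that z0 by auto
  from ae obtain t where t: "t \<in> {0<..<1}" "\<exists>z' y' D.
      (z has_vector_derivative z') (at t) \<and>
      ((\<lambda>t. gradient \<phi> (z t)) has_vector_derivative y') (at t) \<and>
      ((\<lambda>t. h (z t)) has_real_derivative D) (at t) \<and> D \<le> - (\<mu> * (norm z')\<^sup>2)"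
    by (rule AE_unit_interval_witness)
  then obtain y' where y': "((\<lambda>t. gradient \<phi> (z t)) has_vector_derivative y') (at t)" by blast
  have "((\<lambda>t. gradient \<phi> (z t)) has_vector_derivative 0) (at t)"
    by (rule has_vector_derivative_transform_within_open[OF has_vector_derivative_const open_greaterThanLessThan t(1)])
      (simp add: z_const)
  hence "y' = 0" by (rule vector_derivative_unique_at[OF y'])
  thus ?thesis using incl[OF _ y'] t z_const[of t] by simp
qed

text \<open>If the values oscillate, some level \<open>c\<close> inside the range of oscillation is not critical, since the critical
  values have empty interior. Upcrossings of \<open>c\<close> accumulate at a point \<open>xs\<close> with \<open>h xs = c\<close>, and after the last
  value at most \<open>c\<close> the values stay above \<open>c\<close> until they exceed \<open>b\<close>. Reaching \<open>b\<close> takes a fixed amount of time,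
  as the iterates move at bounded speed. So \<open>stationary_if_no_descent\<close> makes \<open>c\<close> critical.\<close>

lemma values_convergent:
  assumes sard: "interior {h y | y. 0 \<in> W y} = {}"
  shows "convergent (\<lambda>n. h (x n))"
proof (rule ccontr)
  assume nc: "\<not> ?thesis"
  define K where "K = closure (range x)"
  have K: "compact K" unfolding K_def by (rule compact_closure_range)
  have "compact (h ` K)" by (intro compact_continuous_image K continuous_on_subset[OF h_cont]) auto
  hence "bounded (range (\<lambda>n. h (x n)))"
    by (rule bounded_subset[OF compact_imp_bounded]) (auto simp: K_def x_in_closure)
  from oscillation_if_not_convergent[OF this nc] obtain a b where ab: "a < b" "\<exists>\<^sub>F n in sequentially. h (x n) < a" "\<exists>\<^sub>F n in sequentially. b < h (x n)"
    by blast
  have "\<not> {a<..<b} \<subseteq> {h y | y. 0 \<in> W y}"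
    using interior_maximal[of "{a<..<b}" "{h y | y. 0 \<in> W y}"] sard ab(1) by auto
  then obtain c where "c \<in> {a<..<b}" and c: "c \<notin> {h y | y. 0 \<in> W y}" by blast
  hence c: "a < c" "c < b" "c \<notin> {h y | y. 0 \<in> W y}" by auto
  define up where "up N p \<longleftrightarrow> N \<le> fst p \<and> fst p < snd p \<and> h (x (fst p)) \<le> c \<and> b < h (x (snd p)) \<and>
      (\<forall>i. fst p < i \<longrightarrow> i \<le> snd p \<longrightarrow> c < h (x i))" for N and p :: "nat \<times> nat"
  have "\<exists>p. up N p" for N
  proof -
    obtain k m where "N \<le> k" "k < m" "h (x k) \<le> c" "b < h (x m)"
        "\<And>i. k < i \<Longrightarrow> i \<le> m \<Longrightarrow> c < h (x i)"
      by (rule last_upcrossing[OF ab(2,3) less_imp_le[OF c(1)] less_imp_le[OF c(2)], where N = N]) blast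
    hence "up N (k, m)" by (simp add: up_def)
    thus ?thesis ..
  qed
  then obtain p where p: "\<And>N. up N (p N)" by metis
  define k m where "k N = fst (p N)" and "m N = snd (p N)" for N
  have km: "N \<le> k N" "k N < m N" "h (x (k N)) \<le> c" "b < h (x (m N))"
      "k N < i \<Longrightarrow> i \<le> m N \<Longrightarrow> c < h (x i)" for N i
    using p[of N] by (simp_all add: up_def k_def m_def)
  have "bounded (range (\<lambda>N. x (k N)))" using bounded_x by (rule bounded_subset) auto
  from bounded_imp_convergent_subsequence[OF this] obtain xs s
    where s: "strict_mono s" "(\<lambda>j. x (k (s j))) \<longlonglongrightarrow> xs" by (auto simp: o_def)
  have "filterlim k at_top sequentially"
    by (rule filterlim_at_top_mono[OF filterlim_ident]) (simp add: km(1))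
  hence ks: "filterlim (\<lambda>j. k (s j)) at_top sequentially"
    by (rule filterlim_compose) (rule filterlim_subseq[OF s(1)])
  have "(\<lambda>j. x (Suc (k (s j))) - x (k (s j))) \<longlonglongrightarrow> 0"
  proof (rule Lim_null_comparison)
    have "(\<lambda>j. C * \<eta> (k (s j))) \<longlonglongrightarrow> C * 0" by (intro tendsto_intros filterlim_compose[OF \<eta>_0 ks])
    thus "(\<lambda>j. C * \<eta> (k (s j))) \<longlonglongrightarrow> 0" by simp
  qed (simp add: step_x)
  from tendsto_add[OF s(2) this] have next_lim: "(\<lambda>j. x (Suc (k (s j)))) \<longlonglongrightarrow> xs" by simp
  have after: "c \<le> h (x (Suc (k N)))" for N
    using km(5)[of N "Suc (k N)"] km(2)[of N] by simp
  have "h xs \<le> c" by (rule tendsto_upperbound[OF h_tendsto[OF s(2)]]) (simp_all add: km(3))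
  moreover have "c \<le> h xs"
    by (rule tendsto_lowerbound[OF h_tendsto[OF next_lim]])
      (simp_all add: after)
  ultimately have hxs: "h xs = c" by simp
  obtain r L where r: "r > 0" "L \<ge> 0" "\<And>u v. v \<in> K \<Longrightarrow> dist u v < r \<Longrightarrow> dist (h u) (h v) \<le> L * dist u v"
    using locally_lipschitz_near_compact[OF h_lipschitz K] by blast
  define T where "T = min (r / 2) ((b - c) / (L + 1)) / (C + 1)"
  have "T > 0" using r(1,2) c C_nonneg by (simp add: T_def)
  have CT: "C * T < r" "L * (C * T) < b - c"
  proof -
    have "C * T \<le> (C + 1) * T" using \<open>T > 0\<close> by (intro mult_right_mono) auto
    also have "\<dots> = min (r / 2) ((b - c) / (L + 1))" using C_nonneg by (simp add: T_def)
    finally have *: "C * T \<le> r / 2" "C * T \<le> (b - c) / (L + 1)" by auto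
    show "C * T < r" using *(1) r(1) by simp
    have "L * (C * T) \<le> L * ((b - c) / (L + 1))" using *(2) r(2) by (rule mult_left_mono)
    also have "\<dots> < b - c" using r(2) c by (simp add: field_simps)
    finally show "L * (C * T) < b - c" .
  qed
  have before: "i \<le> m N" if "k N \<le> i" "S i - S (k N) \<le> T" for i N
  proof (rule ccontr)
    assume "\<not> i \<le> m N"
    hence "m N \<le> i" by simp
    hence "S (m N) - S (k N) \<le> T" using that(2) S_le_iff[of "m N" i] by linarith
    hence "C * \<bar>S (m N) - S (k N)\<bar> \<le> C * T"
      using km(2)[of N] C_nonneg by (intro mult_left_mono) (auto simp: abs_of_nonneg less_imp_le)
    hence d: "dist (x (m N)) (x (k N)) \<le> C * T"
      using x_lipschitz[of "m N" "k N"] by (simp add: dist_norm)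
    have "h (x (m N)) - h (x (k N)) \<le> L * dist (x (m N)) (x (k N))"
      using r(3)[of "x (k N)" "x (m N)"] d CT(1) by (simp add: K_def x_in_closure dist_real_def)
    also have "\<dots> \<le> L * (C * T)" using d r(2) by (rule mult_left_mono)
    finally show False using CT(2) km(3,4)[of N] by linarith
  qed
  have "0 \<in> W xs"
  proof (rule stationary_if_no_descent[OF ks s(2) \<open>T > 0\<close>])
    fix \<epsilon> :: real assume "\<epsilon> > 0"
    have "\<forall>\<^sub>F j in sequentially. c - \<epsilon> < h (x (k (s j)))"
      using h_tendsto[OF s(2)] \<open>\<epsilon> > 0\<close> hxs by (intro order_tendstoD(1)) auto
    thus "\<forall>\<^sub>F j in sequentially. \<forall>i\<ge>k (s j). S i - S (k (s j)) \<le> T \<longrightarrow> h xs - \<epsilon> \<le> h (x i)"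
    proof eventually_elim
      case (elim j)
      show ?case
      proof (intro allI impI)
        fix i assume i: "k (s j) \<le> i" "S i - S (k (s j)) \<le> T"
        show "h xs - \<epsilon> \<le> h (x i)"
          using km(5)[of "s j" i] before[OF i] elim i(1) hxs \<open>\<epsilon> > 0\<close> by (cases "i = k (s j)") auto
      qed
    qed
  qed
  thus False using c(3) hxs by blast
qed

text \<open>Convergent values tend to \<open>h xs\<close> at every cluster point \<open>xs\<close>, so eventually no iterate is below it by a
  fixed amount.\<close>

lemma cluster_point_stationary:
  assumes conv: "convergent (\<lambda>n. h (x n))" and r: "strict_mono r" "(\<lambda>j. x (r j)) \<longlonglongrightarrow> xs"
  shows "0 \<in> W xs"
proof -
  obtain l where l: "(\<lambda>n. h (x n)) \<longlonglongrightarrow> l" using conv by (auto simp: convergent_def)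
  have rtop: "filterlim r at_top sequentially" by (rule filterlim_subseq[OF r(1)])
  have "(\<lambda>j. h (x (r j))) \<longlonglongrightarrow> l" by (rule filterlim_compose[OF l rtop])
  hence hxs: "h xs = l" by (rule LIMSEQ_unique[OF h_tendsto[OF r(2)]])
  show ?thesis
  proof (rule stationary_if_no_descent[OF rtop r(2), of 1])
    fix \<epsilon> :: real assume "\<epsilon> > 0"
    hence "\<forall>\<^sub>F n in sequentially. l - \<epsilon> < h (x n)" using l by (intro order_tendstoD(1)) auto
    then obtain N where N: "\<And>n. n \<ge> N \<Longrightarrow> l - \<epsilon> < h (x n)" unfolding eventually_sequentially by blast
    have "\<forall>\<^sub>F j in sequentially. N \<le> r j" using rtop unfolding filterlim_at_top by blast
    thus "\<forall>\<^sub>F j in sequentially. \<forall>i\<ge>r j. S i - S (r j) \<le> 1 \<longrightarrow> h xs - \<epsilon> \<le> h (x i)"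
    proof eventually_elim
      case (elim j)
      show ?case using N order_trans[OF elim] hxs less_imp_le by metis
    qed
  qed simp
qed

end

section \<open>Trajectories of the method\<close>

text \<open>A diagonal argument: each \<open>u n\<close> is approximated by a regular normal vector at a point near \<open>p n\<close>.\<close>

lemma closed_graph_limiting_normal_cone:
  assumes "closed X" and u: "\<And>n::nat. u n \<in> limiting_normal_cone X (p n)"
    and p: "p \<longlonglongrightarrow> q" and v: "u \<longlonglongrightarrow> v"
  shows "v \<in> limiting_normal_cone X q"
proof -
  have "p n \<in> X" for n using u[of n] by (simp add: limiting_normal_cone_def)
  hence "q \<in> X" using closed_sequentially[OF \<open>closed X\<close>] p by blast
  have "\<exists>a. fst a \<in> X \<and> snd a \<in> regular_normal_cone X (fst a) \<and>
      dist (fst a) (p n) < inverse (real (Suc n)) \<and> dist (snd a) (u n) < inverse (real (Suc n))" for n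
  proof -
    obtain xs vs where s: "\<And>k::nat. xs k \<in> X" "\<And>k. vs k \<in> regular_normal_cone X (xs k)"
        "xs \<longlonglongrightarrow> p n" "vs \<longlonglongrightarrow> u n"
      using u[of n] unfolding limiting_normal_cone_def by blast
    have "\<forall>\<^sub>F k in sequentially. dist (xs k) (p n) < inverse (real (Suc n)) \<and> dist (vs k) (u n) < inverse (real (Suc n))"
      by (intro eventually_conj tendstoD s) simp_all
    then obtain k where "dist (xs k) (p n) < inverse (real (Suc n)) \<and> dist (vs k) (u n) < inverse (real (Suc n))"
      using eventually_happens'[OF sequentially_bot] by blast
    thus ?thesis using s by (intro exI[of _ "(xs k, vs k)"]) simp
  qed
  then obtain a where a: "\<And>n. fst (a n) \<in> X" "\<And>n. snd (a n) \<in> regular_normal_cone X (fst (a n))"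
      "\<And>n. dist (fst (a n)) (p n) < inverse (real (Suc n))"
      "\<And>n. dist (snd (a n)) (u n) < inverse (real (Suc n))"
    by metis
  have close: "b \<longlonglongrightarrow> l" if "c \<longlonglongrightarrow> l" "\<And>n. dist (b n) (c n) < inverse (real (Suc n))"
    for b c :: "nat \<Rightarrow> 'a" and l
  proof -
    have "(\<lambda>n. b n - c n) \<longlonglongrightarrow> 0"
      by (rule Lim_null_comparison[OF _ LIMSEQ_inverse_real_of_nat])
        (rule always_eventually, rule allI, use that(2) in \<open>simp add: dist_norm less_imp_le del: of_nat_Suc\<close>)
    from tendsto_add[OF that(1) this] show ?thesis by simp
  qed
  have "(\<lambda>n. fst (a n)) \<longlonglongrightarrow> q" by (rule close[OF p a(3)])
  moreover have "(\<lambda>n. snd (a n)) \<longlonglongrightarrow> v" by (rule close[OF v a(4)])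
  ultimately show ?thesis
    using \<open>q \<in> X\<close> a(1,2) unfolding limiting_normal_cone_def
    by (intro CollectI conjI exI[of _ "\<lambda>n. fst (a n)"] exI[of _ "\<lambda>n. snd (a n)"]) auto
qed

lemma conservative_field_closed_graph:
  assumes "conservative_field D f" "\<And>n::nat. u n \<in> D (p n)" "p \<longlonglongrightarrow> q" "u \<longlonglongrightarrow> v"
  shows "v \<in> D q"
proof -
  have cl: "closed {(x, v). v \<in> D x}" using assms(1) by (simp add: conservative_field_def)
  have "(\<lambda>n. (p n, u n)) \<longlonglongrightarrow> (q, v)" by (intro tendsto_Pair assms)
  from closed_sequentially[OF cl _ this] show ?thesis using assms(2) by simp
qed

text \<open>The normal cone is the closed convex hull of the limiting normal cone and need not have a closed graph.
  Since the vectors produced by the method are bounded, they can be kept in bounded parts of the three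
  sets; taking the convex hull only after truncation yields a field with compact convex values
  and the required closure property.\<close>

definition truncated_field ::
    "real \<Rightarrow> ('a::euclidean_space \<Rightarrow> 'a set) \<Rightarrow> ('a \<Rightarrow> 'a set) \<Rightarrow> 'a set \<Rightarrow> 'a \<Rightarrow> 'a set" where
  "truncated_field B Df DR X z =
    (Df z \<inter> cball 0 B) + (DR z \<inter> cball 0 B) + convex hull (limiting_normal_cone X z \<inter> cball 0 B)"

lemma compact_set_plus:
  fixes A B :: "'a::real_normed_vector set"
  assumes "compact A" "compact B" shows "compact (A + B)"
proof -
  have "A + B = {x + y |x y. x \<in> A \<and> y \<in> B}" by (auto simp: set_plus_def)
  thus ?thesis using compact_sums[OF assms] by simp
qed

lemma compact_truncated_field:
  assumes "conservative_field Df f" "conservative_field DR R" "closed X"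
  shows "compact (truncated_field B Df DR X z)"
proof -
  have "compact (Df z \<inter> cball 0 B)" "compact (DR z \<inter> cball 0 B)"
    using assms(1,2) by (auto simp: conservative_field_def intro: closed_Int_compact)
  moreover have "closed (limiting_normal_cone X z)"
    unfolding closed_sequential_limits
    using closed_graph_limiting_normal_cone[OF assms(3) _ tendsto_const] by blast
  hence "compact (convex hull (limiting_normal_cone X z \<inter> cball 0 B))"
    by (intro compact_convex_hull closed_Int_compact) auto
  ultimately show ?thesis unfolding truncated_field_def by (intro compact_set_plus)
qed

lemma convex_truncated_field:
  assumes "\<And>y. convex (Df y)" "\<And>y. convex (DR y)"
  shows "convex (truncated_field B Df DR X z)"
  unfolding truncated_field_def
  by (intro convex_set_plus convex_Int assms convex_cball convex_convex_hull)

lemma truncated_field_subset: "truncated_field B Df DR X z \<subseteq> Df z + DR z + normal_cone X z"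
proof -
  have "convex hull (limiting_normal_cone X z \<inter> cball 0 B) \<subseteq> normal_cone X z"
    unfolding normal_cone_def using closure_subset hull_mono[of _ "limiting_normal_cone X z" convex]
    by (meson Int_lower1 order_trans)
  thus ?thesis unfolding truncated_field_def by (intro set_plus_mono2) auto
qed

context step_sizes begin

text \<open>The analysis of a single trajectory whose noise averages out over short windows. The work is to bound
  the increments of \<open>x\<close> and of \<open>gradient \<phi> \<circ> x\<close>, from the update also the normal
  vectors \<open>dX\<close>, and to verify the closure property of \<open>truncated_field\<close>.\<close>

lemma sbpg_trajectory_converges:
  fixes x df dR dX de \<xi> :: "nat \<Rightarrow> 'a::euclidean_space"
  assumes traj: "sbpg_trajectory X \<phi> R Df DR \<eta> \<delta> \<nu> x df dR dX de \<xi>"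
    and X: "closed X" "admits_chain_rule X"
    and \<phi>: "legendre_kernel \<phi>" "locally_strongly_convex \<phi>" "locally_lipschitz (gradient \<phi>)"
    and bdd: "bounded (range x)" "bounded (range df)" "bounded (range dR)"
    and \<xi>_le: "\<And>k. norm (\<xi> k) \<le> C\<xi>"
    and noise: "\<And>p. (\<lambda>n. \<Sum>i=n..<idx (S n + 1 / real (Suc p)). \<eta> i *\<^sub>R \<xi> i) \<longlonglongrightarrow> 0"
    and \<delta>: "\<delta> \<longlonglongrightarrow> 0" and \<nu>: "\<nu> \<longlonglongrightarrow> 0"
    and Df: "conservative_field Df f" "\<And>y. convex (Df y)"
    and DR: "conservative_field DR R" "\<And>y. convex (DR y)"
    and sard: "interior {f y + R y | y. 0 \<in> Df y + DR y + normal_cone X y} = {}"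
  shows "convergent (\<lambda>k. f (x k) + R (x k))"
    and "strict_mono r \<Longrightarrow> (\<lambda>k. x (r k)) \<longlonglongrightarrow> xs \<Longrightarrow> 0 \<in> Df xs + DR xs + normal_cone X xs"
proof -
  let ?\<Phi> = "gradient \<phi>"
  have x_X: "\<And>k. x k \<in> X" and df: "\<And>k. df k \<in> enlargement (\<delta> k) Df (x k)"
    and descent: "\<And>k. (df k + \<xi> k) \<bullet> (x (Suc k) - x k) + 1 / \<eta> k * bregman \<phi> (x (Suc k)) (x k) + R (x (Suc k)) \<le> R (x k)"
    and dR: "\<And>k. dR k \<in> DR (x (Suc k))" and dX: "\<And>k. dX k \<in> limiting_normal_cone X (x (Suc k))"
    and de: "\<And>k. norm (de k) \<le> \<nu> k"
    and upd: "\<And>k. ?\<Phi> (x (Suc k)) = ?\<Phi> (x k) - \<eta> k *\<^sub>R (df k + dR k + dX k + de k + \<xi> k)"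
    using traj unfolding sbpg_trajectory_def by auto
  have \<phi>_diff: "\<And>y. \<phi> differentiable (at y)" and \<phi>_conv: "convex_on UNIV \<phi>"
    and \<Phi>_cont: "continuous_on UNIV ?\<Phi>"
    using \<phi>(1) by (auto simp: legendre_kernel_def convex_on_if_strictly_convex)
  obtain Bf where Bf: "\<And>k. norm (df k) \<le> Bf" using bdd(2) unfolding bounded_iff by auto
  obtain BR where BR: "\<And>k. norm (dR k) \<le> BR" using bdd(3) unfolding bounded_iff by auto
  obtain B\<nu> where B\<nu>: "\<And>k. \<nu> k \<le> B\<nu>"
  proof -
    have "Bseq \<nu>" using \<nu> by (intro convergent_imp_Bseq) (auto simp: convergent_def)
    then obtain K where "\<And>n. norm (\<nu> n) \<le> K" by (auto simp: Bseq_def)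
    thus ?thesis using that[of K] by (metis abs_le_D1 real_norm_def)
  qed
  obtain C1 where C1: "C1 \<ge> 0" "\<And>k. norm (x (Suc k) - x k) \<le> C1 * \<eta> k"
  proof (rule step_size_bound[OF \<phi>_conv \<phi>(2) \<phi>_diff _ bdd(1) _ \<eta>_pos \<eta>_0 descent, of "Bf + C\<xi>"])
    show "locally_lipschitz R" using DR(1) by (simp add: conservative_field_def)
    show "norm (df k + \<xi> k) \<le> Bf + C\<xi>" for k
      using norm_triangle_ineq[of "df k" "\<xi> k"] Bf[of k] \<xi>_le[of k] by linarith
  qed (rule that)
  have C1\<eta>: "(\<lambda>k. C1 * \<eta> k) \<longlonglongrightarrow> 0" using tendsto_mult_left[OF \<eta>_0, of C1] by simp
  obtain C2 where C2: "C2 \<ge> 0" "\<And>k. norm (?\<Phi> (x (Suc k)) - ?\<Phi> (x k)) \<le> C2 * \<eta> k"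
  proof -
    have "compact (closure (range x))" using bdd(1) by simp
    then obtain \<rho> L where \<rho>: "\<rho> > 0" "L \<ge> 0"
      "\<And>u v. v \<in> closure (range x) \<Longrightarrow> dist u v < \<rho> \<Longrightarrow> dist (?\<Phi> u) (?\<Phi> v) \<le> L * dist u v"
      using locally_lipschitz_near_compact[OF \<phi>(3)] by metis
    have "\<forall>\<^sub>F k in sequentially. C1 * \<eta> k < \<rho>" using C1\<eta> \<rho>(1) by (rule order_tendstoD)
    hence "\<forall>\<^sub>F k in sequentially. norm (?\<Phi> (x (Suc k)) - ?\<Phi> (x k)) \<le> (L * C1) * \<eta> k"
    proof eventually_elim
      case (elim k)
      have "x k \<in> closure (range x)" by (meson closure_subset rangeI subsetD)
      moreover have "dist (x (Suc k)) (x k) < \<rho>" using C1(2)[of k] elim by (simp add: dist_norm)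
      ultimately have "norm (?\<Phi> (x (Suc k)) - ?\<Phi> (x k)) \<le> L * norm (x (Suc k) - x k)"
        using \<rho>(3)[of "x k" "x (Suc k)"] by (simp add: dist_norm)
      also have "\<dots> \<le> L * (C1 * \<eta> k)" using C1(2) \<rho>(2) by (rule mult_left_mono)
      finally show ?case by (simp add: mult.assoc)
    qed
    from eventually_le_imp_le_multiple[OF \<eta>_pos this] show ?thesis using that by blast
  qed
  \<comment> \<open>The update expresses \<open>dX k\<close> by bounded vectors and by an increment of the gradient divided by \<open>\<eta> k\<close>.\<close>
  have BX: "norm (dX k) \<le> C2 + Bf + BR + B\<nu> + C\<xi>" for k
  proof -
    define w where "w = df k + dR k + dX k + de k + \<xi> k"
    have "\<eta> k * norm w = norm (?\<Phi> (x (Suc k)) - ?\<Phi> (x k))"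
      using upd[of k] \<eta>_pos[of k] by (simp add: w_def)
    also have "\<dots> \<le> C2 * \<eta> k" by (rule C2)
    finally have "norm w \<le> C2" using \<eta>_pos[of k] by (simp add: mult.commute)
    have "dX k = w - df k - dR k - de k - \<xi> k" by (simp add: w_def)
    hence "norm (dX k) \<le> norm w + norm (df k) + norm (dR k) + norm (de k) + norm (\<xi> k)"
      using norm_triangle_ineq4[of "w - df k - dR k - de k" "\<xi> k"] norm_triangle_ineq4[of "w - df k - dR k" "de k"]
        norm_triangle_ineq4[of "w - df k" "dR k"] norm_triangle_ineq4[of w "df k"] by simp
    thus ?thesis using \<open>norm w \<le> C2\<close> Bf[of k] BR[of k] de[of k] B\<nu>[of k] \<xi>_le[of k] by linarith
  qed
  define B where "B = Max {Bf, BR, C2 + Bf + BR + B\<nu> + C\<xi>}"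
  have B: "norm (df k) \<le> B" "norm (dR k) \<le> B" "norm (dX k) \<le> B" for k
    unfolding B_def using Bf[of k] BR[of k] BX[of k] by auto
  define W where "W = truncated_field B Df DR X"
  define d where "d k = df k + dR k + dX k + de k" for k
  have next_lim: "(\<lambda>n. x (Suc (r n))) \<longlonglongrightarrow> z"
    if r: "filterlim r at_top sequentially" "(\<lambda>n. x (r n)) \<longlonglongrightarrow> z" for r :: "nat \<Rightarrow> nat" and z
  proof -
    have "(\<lambda>n. x (Suc (r n)) - x (r n)) \<longlonglongrightarrow> 0"
      by (rule Lim_null_comparison[OF _ filterlim_compose[OF C1\<eta> r(1)]]) (simp add: C1)
    from tendsto_add[OF r(2) this] show ?thesis by simp
  qed
  have W_limit: "v \<in> W z"
    if r0: "filterlim r0 at_top sequentially" "(\<lambda>n. x (r0 n)) \<longlonglongrightarrow> z" "(\<lambda>n. d (r0 n)) \<longlonglongrightarrow> v" for r0 z v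
  proof -
    \<comment> \<open>The sum \<open>d\<close> converges, its summands only do so along a subsequence.\<close>
    have "bounded (range (\<lambda>n. (df (r0 n), dR (r0 n), dX (r0 n))))"
      by (rule bounded_subset[of "cball 0 B \<times> cball 0 B \<times> cball 0 B"])
        (use B in \<open>auto intro!: bounded_Times\<close>)
    from bounded_imp_convergent_subsequence[OF this] obtain l s
      where s: "strict_mono s" and l: "(\<lambda>n. (df (r0 (s n)), dR (r0 (s n)), dX (r0 (s n)))) \<longlonglongrightarrow> l"
      by (auto simp: o_def)
    obtain a b c where abc: "l = (a, b, c)" by (cases l)
    define r where "r n = r0 (s n)" for n
    have stop: "filterlim s at_top sequentially" by (rule filterlim_subseq[OF s])
    have rtop: "filterlim r at_top sequentially" and rx: "(\<lambda>n. x (r n)) \<longlonglongrightarrow> z"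
      and rd: "(\<lambda>n. d (r n)) \<longlonglongrightarrow> v"
      unfolding r_def using filterlim_compose[OF r0(1) stop] filterlim_compose[OF r0(2) stop]
        filterlim_compose[OF r0(3) stop] by simp_all
    have a: "(\<lambda>n. df (r n)) \<longlonglongrightarrow> a" using tendsto_fst[OF l] by (simp add: abc r_def)
    have b: "(\<lambda>n. dR (r n)) \<longlonglongrightarrow> b" using tendsto_fst[OF tendsto_snd[OF l]] by (simp add: abc r_def)
    have c: "(\<lambda>n. dX (r n)) \<longlonglongrightarrow> c" using tendsto_snd[OF tendsto_snd[OF l]] by (simp add: abc r_def)
    have "(\<lambda>n. de (r n)) \<longlonglongrightarrow> 0"
      by (rule Lim_null_comparison[OF _ filterlim_compose[OF \<nu> rtop]]) (simp add: de)
    hence "(\<lambda>n. d (r n)) \<longlonglongrightarrow> a + b + c + 0" unfolding d_def by (intro tendsto_add a b c)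
    hence v: "v = a + b + c" using LIMSEQ_unique[OF rd] by simp
    have "a \<in> Df z"
    proof -
      have "\<exists>p u. dist (x k) p \<le> \<delta> k \<and> u \<in> Df p \<and> norm (df k - u) \<le> \<delta> k" for k
      proof -
        obtain p u e where "p \<in> cball (x k) (\<delta> k)" "u \<in> Df p" "e \<in> cball 0 (\<delta> k)" "df k = u + e"
          using df[of k] unfolding enlargement_def by (auto elim!: set_plus_elim)
        thus ?thesis by (intro exI[of _ p] exI[of _ u]) simp
      qed
      then obtain p u where pu: "\<And>k. dist (x k) (p k) \<le> \<delta> k" "\<And>k. u k \<in> Df (p k)" "\<And>k. norm (df k - u k) \<le> \<delta> k"
        by metis
      have "(\<lambda>n. x (r n) - p (r n)) \<longlonglongrightarrow> 0"
        by (rule Lim_null_comparison[OF _ filterlim_compose[OF \<delta> rtop]]) (use pu(1) in \<open>simp add: dist_norm\<close>)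
      from tendsto_diff[OF rx this] have "(\<lambda>n. p (r n)) \<longlonglongrightarrow> z" by simp
      moreover have "(\<lambda>n. df (r n) - u (r n)) \<longlonglongrightarrow> 0"
        by (rule Lim_null_comparison[OF _ filterlim_compose[OF \<delta> rtop]]) (simp add: pu(3))
      from tendsto_diff[OF a this] have "(\<lambda>n. u (r n)) \<longlonglongrightarrow> a" by simp
      ultimately show ?thesis
        by (rule conservative_field_closed_graph[OF Df(1), rotated]) (rule pu(2))
    qed
    moreover have "b \<in> DR z"
      by (rule conservative_field_closed_graph[OF DR(1) dR next_lim[OF rtop rx] b])
    moreover have "c \<in> limiting_normal_cone X z"
      by (rule closed_graph_limiting_normal_cone[OF X(1) dX next_lim[OF rtop rx] c])
    moreover have "norm a \<le> B" by (rule Lim_norm_ubound[OF sequentially_bot a]) (simp add: B)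
    moreover have "norm b \<le> B" by (rule Lim_norm_ubound[OF sequentially_bot b]) (simp add: B)
    moreover have "norm c \<le> B" by (rule Lim_norm_ubound[OF sequentially_bot c]) (simp add: B)
    ultimately show ?thesis
      unfolding v W_def truncated_field_def by (intro set_plus_intro hull_inc) auto
  qed
  define C where "C = Max {C1, C2, C\<xi>}"
  have C: "C1 \<le> C" "C2 \<le> C" "C\<xi> \<le> C" by (auto simp: C_def)
  interpret bregman_inclusion \<eta> S idx x d \<xi> W C \<phi> f R Df DR X "\<lambda>y. f y + R y"
  proof unfold_locales
    show "norm (x (Suc k) - x k) \<le> C * \<eta> k" for k
      using C1(2)[of k] mult_right_mono[OF C(1), of "\<eta> k"] \<eta>_pos[of k] by linarith
    show "norm (?\<Phi> (x (Suc k)) - ?\<Phi> (x k)) \<le> C * \<eta> k" for k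
      using C2(2)[of k] mult_right_mono[OF C(2), of "\<eta> k"] \<eta>_pos[of k] by linarith
    show "norm (\<xi> k) \<le> C" for k using \<xi>_le[of k] C(3) by linarith
    show "?\<Phi> (x (Suc k)) = ?\<Phi> (x k) - \<eta> k *\<^sub>R (d k + \<xi> k)" for k
      using upd[of k] by (simp add: d_def)
    show "bounded (range d)"
    proof (rule boundedI)
      fix w assume "w \<in> range d"
      then obtain k where w: "w = df k + dR k + dX k + de k" unfolding d_def by blast
      show "norm w \<le> B + B + B + B\<nu>"
        using norm_triangle_ineq[of "df k + dR k + dX k" "de k"] norm_triangle_ineq[of "df k + dR k" "dX k"]
          norm_triangle_ineq[of "df k" "dR k"] B[of k] de[of k] B\<nu>[of k] unfolding w by linarith
    qed
    show "closed (W z)" for z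
      unfolding W_def by (intro compact_imp_closed compact_truncated_field[OF Df(1) DR(1) X(1)])
    show "convex (W z)" for z
      unfolding W_def by (rule convex_truncated_field[OF Df(2) DR(2)])
    show "W z \<subseteq> Df z + DR z + normal_cone X z" for z
      unfolding W_def by (rule truncated_field_subset)
  qed (use \<Phi>_cont bdd noise[unfolded idx_def S_def] \<phi> \<phi>_diff X Df DR x_X W_limit in auto)
  have "interior {f y + R y | y. 0 \<in> W y} \<subseteq> interior {f y + R y | y. 0 \<in> Df y + DR y + normal_cone X y}"
    using W_subset by (intro interior_mono) blast
  hence "interior {f y + R y | y. 0 \<in> W y} = {}" using sard by blast
  thus conv: "convergent (\<lambda>k. f (x k) + R (x k))" by (rule values_convergent)
  show "0 \<in> Df xs + DR xs + normal_cone X xs"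
    if "strict_mono r" "(\<lambda>k. x (r k)) \<longlonglongrightarrow> xs" for r xs
    using cluster_point_stationary[OF conv that] W_subset by blast
qed

end

theorem theorem4p3:
  fixes M :: "'w measure"
    and X :: "(real ^ 'n) set"
    and f R \<phi> :: "real ^ 'n \<Rightarrow> real"
    and Df DR :: "real ^ 'n \<Rightarrow> (real ^ 'n) set"
    and \<eta> \<delta> \<nu> :: "nat \<Rightarrow> real"
    and x df dR dX de \<xi> :: "nat \<Rightarrow> 'w \<Rightarrow> real ^ 'n"
  defines "h \<equiv> (\<lambda>y. f y + R y)"
    and "H \<equiv> (\<lambda>y. Df y + DR y + normal_cone X y)"
  assumes "prob_space M"
    and "closed X"
    and "locally_lipschitz f" and "locally_lipschitz R"
    and "\<And>k. 0 < \<eta> k" and "\<And>k. 0 \<le> \<delta> k" and "\<And>k. 0 \<le> \<nu> k"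
    and "AE \<omega> in M. sbpg_trajectory X \<phi> R Df DR \<eta> \<delta> \<nu>
           (\<lambda>k. x k \<omega>) (\<lambda>k. df k \<omega>) (\<lambda>k. dR k \<omega>) (\<lambda>k. dX k \<omega>) (\<lambda>k. de k \<omega>) (\<lambda>k. \<xi> k \<omega>)"
    and "legendre_kernel \<phi>" and "supercoercive \<phi>" and "locally_strongly_convex \<phi>"
    and "locally_lipschitz (gradient \<phi>)"
    and "\<And>z. abs_continuous_halfline z \<Longrightarrow>
           AE s in lborel. 0 \<le> s \<longrightarrow> hessian_pos_def_at \<phi> (z s)"
    and "AE \<omega> in M. bounded (range (\<lambda>k. x k \<omega>)) \<and> bounded (range (\<lambda>k. gradient \<phi> (x k \<omega>))) \<and>
           bounded (range (\<lambda>k. df k \<omega>)) \<and> bounded (range (\<lambda>k. dR k \<omega>))"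
    and "bounded_martingale_difference M \<xi>"
    and "filterlim (\<lambda>N. \<Sum>k<N. \<eta> k) at_top sequentially"
    and "\<eta> \<in> o(\<lambda>k. 1 / ln (real k))"
    and "\<delta> \<longlonglongrightarrow> 0" and "\<nu> \<longlonglongrightarrow> 0"
    and "\<And>e. 0 < e \<Longrightarrow> supercoercive (\<lambda>y. e * R y + \<phi> y)"
    and "bdd_below (range h)"
    and "conservative_field Df f" and "\<And>y. convex (Df y)"
    and "conservative_field DR R" and "\<And>y. convex (DR y)"
    and "admits_chain_rule X"
    and "interior {h y | y. 0 \<in> H y} = {}"
  shows "AE \<omega> in M.
           (\<forall>xs. (\<exists>r. strict_mono r \<and> (\<lambda>k. x (r k) \<omega>) \<longlonglongrightarrow> xs) \<longrightarrow> 0 \<in> H xs) \<and>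
           convergent (\<lambda>k. f (x k \<omega>) + R (x k \<omega>))"
proof -
  interpret prob_space M by fact
  let ?S = "\<lambda>n. \<Sum>i<n. \<eta> i"
  let ?idx = "\<lambda>\<tau>. LEAST i. \<tau> \<le> ?S i"
  have \<eta>_0: "\<eta> \<longlonglongrightarrow> 0"
  proof -
    have "(\<lambda>k::nat. 1 / ln (real k)) \<longlonglongrightarrow> 0"
      by (intro tendsto_divide_0[OF tendsto_const] filterlim_at_top_imp_at_infinity
          filterlim_compose[OF ln_at_top filterlim_real_sequentially])
    hence "(\<lambda>k::nat. norm (1 / ln (real k))) \<longlonglongrightarrow> 0" by (rule tendsto_norm_zero)
    moreover have "\<forall>\<^sub>F k in sequentially. norm (\<eta> k) \<le> 1 * norm (1 / ln (real k))"
      using \<open>\<eta> \<in> o(\<lambda>k. 1 / ln (real k))\<close> by (rule landau_o.smallD) simp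
    hence "\<forall>\<^sub>F k in sequentially. norm (\<eta> k) \<le> norm (1 / ln (real k))" by simp
    ultimately show ?thesis by (rule Lim_null_comparison[rotated])
  qed
  interpret step_sizes \<eta> ?S ?idx
    by unfold_locales (fact \<eta>_0 \<open>\<And>k. 0 < \<eta> k\<close> \<open>filterlim (\<lambda>N. \<Sum>k<N. \<eta> k) at_top sequentially\<close>)+
  have windows: "AE \<omega> in M. \<forall>p. (\<lambda>n. \<Sum>i=n..<?idx (?S n + 1 / real (Suc p)). \<eta> i *\<^sub>R \<xi> i \<omega>) \<longlonglongrightarrow> 0"
    unfolding AE_all_countable
  proof
    fix p
    show "AE \<omega> in M. (\<lambda>n. \<Sum>i=n..<?idx (?S n + 1 / real (Suc p)). \<eta> i *\<^sub>R \<xi> i \<omega>) \<longlonglongrightarrow> 0"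
    proof (rule window_noise_tendsto_0_vector)
      show ge: "n \<le> ?idx (?S n + 1 / real (Suc p))" for n by (rule idx_ge_start) simp
      have "(\<lambda>n. ?S (?idx (?S n + 1 / real (Suc p))) - ?S n) \<longlonglongrightarrow> 1 / real (Suc p)"
        by (rule S_idx_tendsto[OF filterlim_ident]) simp
      hence "\<forall>\<^sub>F n in sequentially. ?S (?idx (?S n + 1 / real (Suc p))) - ?S n < 1 / real (Suc p) + 1"
        by (rule order_tendstoD(2)) simp
      thus "\<forall>\<^sub>F n in sequentially. (\<Sum>i=n..<?idx (?S n + 1 / real (Suc p)). \<eta> i) \<le> 1 / real (Suc p) + 1"
        unfolding S_diff[OF ge] by (rule eventually_mono) (rule less_imp_le)
      show "0 < \<eta> k" for k by fact
    qed (fact \<open>prob_space M\<close> \<open>bounded_martingale_difference M \<xi>\<close> \<open>\<eta> \<in> o(\<lambda>k. 1 / ln (real k))\<close>)+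
  qed
  obtain C\<xi> where "\<And>k. AE \<omega> in M. norm (\<xi> k \<omega>) \<le> C\<xi>"
    using \<open>bounded_martingale_difference M \<xi>\<close> unfolding bounded_martingale_difference_def
    by (elim conjE exE) (rule that, erule spec)
  hence noise_bound: "AE \<omega> in M. \<forall>k. norm (\<xi> k \<omega>) \<le> C\<xi>" by (simp add: AE_all_countable)
  \<comment> \<open>The numbered hypotheses are that almost every path is a trajectory and that its iterates, its
    gradients and its subgradients are bounded.\<close>
  show ?thesis
    using windows noise_bound assms(10,16)
  proof eventually_elim
    case (elim \<omega>)
    have sard: "interior {f y + R y | y. 0 \<in> Df y + DR y + normal_cone X y} = {}"
      using \<open>interior {h y | y. 0 \<in> H y} = {}\<close> unfolding h_def H_def .
    have noise: "(\<lambda>n. \<Sum>i=n..<?idx (?S n + 1 / real (Suc p)). \<eta> i *\<^sub>R \<xi> i \<omega>) \<longlonglongrightarrow> 0" for p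
      using elim(1) ..
    have bound: "norm (\<xi> k \<omega>) \<le> C\<xi>" for k using elim(2) ..
    have bdd: "bounded (range (\<lambda>k. x k \<omega>))" "bounded (range (\<lambda>k. df k \<omega>))" "bounded (range (\<lambda>k. dR k \<omega>))"
      using elim(4) by auto
    note conv = sbpg_trajectory_converges[where f = f, OF elim(3) \<open>closed X\<close> \<open>admits_chain_rule X\<close>
        \<open>legendre_kernel \<phi>\<close> \<open>locally_strongly_convex \<phi>\<close> \<open>locally_lipschitz (gradient \<phi>)\<close>
        bdd bound noise \<open>\<delta> \<longlonglongrightarrow> 0\<close> \<open>\<nu> \<longlonglongrightarrow> 0\<close> \<open>conservative_field Df f\<close> \<open>\<And>y. convex (Df y)\<close>
        \<open>conservative_field DR R\<close> \<open>\<And>y. convex (DR y)\<close> sard]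
    show ?case unfolding H_def
    proof (intro conjI allI impI)
      fix xs assume "\<exists>r. strict_mono r \<and> (\<lambda>k. x (r k) \<omega>) \<longlonglongrightarrow> xs"
      then obtain r where "strict_mono r" "(\<lambda>k. x (r k) \<omega>) \<longlonglongrightarrow> xs" by blast
      thus "0 \<in> Df xs + DR xs + normal_cone X xs" by (rule conv(2))
    qed (rule conv(1))
  qed
qed

end
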